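(* Let $\kappa>0$, $r>0$, $t>0$, let $g$ be a function on $(0,\infty)$ with Mellin transform $\mathfrak{M}(g)$, and let $u(r,t)$ be the solution of the axisymmetric diffusion equation with initial data $u(r,0)=g(r)$. If $\mathfrak{M}(g)(1-s)$ is analytic in a subset $S$ of the region $\{s\in\mathbb{C}:\Re(s)>-1\}$, then for $c\in S\cap\{s\in\mathbb{C}:\Re(s)>-1\}$, $$u(r,t)=\frac{1}{r}e^{-(r^2-\frac{r^2}{2})/(4\kappa t)}\frac{1}{2\pi i}\int_{(c)}\Gamma\left(\frac{s}{2}+\frac{1}{2}\right)(4\kappa t)^{s/2}M_{-s/2,0}\left(\frac{r^2}{4\kappa t}\right)\mathfrak{M}(g)(1-s)\,ds.$$
   Context: The axisymmetric diffusion equation with diffusivity constant $\kappa>0$ is $\kappa\left(u_{rr}+\frac{1}{r}u_r\right)=u_t$ for $r\in(0,\infty)$, $t>0$, with initial condition $u(r,0)=g(r)$. Its solution means the explicit solution $$u(r,t)=\frac{1}{2\kappa t}e^{-r^2/(4\kappa t)}\int_{0}^{\infty}y\,g(y)\,I_0\left(\frac{yr}{2\kappa t}\right)e^{-y^2/(4\kappa t)}\,dy,$$ where $I_v(x)=\sum_{n\ge0}\frac{1}{n!\,\Gamma(v+n+1)}\left(\frac{x}{2}\right)^{2n+v}$ is the modified Bessel function of the first kind (it is understood that $g$ is such that this integral converges). The Mellin transform is $\mathfrak{M}(g)(s)=\int_0^\infty y^{s-1}g(y)\,dy$, wherever this integral converges. $M_{\mu,v}(x)=x^{v+\frac12}e^{-x/2}\,{}_1F_1\left(v-\mu+\tfrac12;2v+1;x\right)$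 is the Whittaker function, with ${}_1F_1(a;b;x)=\sum_{k\ge 0}\frac{(a)_k}{(b)_k}\frac{x^k}{k!}$ the confluent hypergeometric function, $(a)_k=a(a+1)\cdots(a+k-1)$. $\int_{(c)}$ denotes integration along the vertical line from $c-i\infty$ to $c+i\infty$. *)

theory Defs
  imports "HOL-Analysis.Analysis"
begin

text \<open>
  All integrals are Henstock--Kurzweil integrals, so that ``the integral converges''
  (\<open>integrable_on\<close>) covers both Lebesgue integrability and convergence as an
  improper integral.
\<close>

text \<open>
  Intended for positive arguments \<open>x\<close> (real powers; in particular \<open>0 powr 0 = 0\<close>,
  so the value at \<open>x = 0\<close> is not the usual one when \<open>v = 0\<close>).
\<close>
definition bessel_I :: "real \<Rightarrow> real \<Rightarrow> real" where
  "bessel_I v x = (\<Sum>n. 1 / (fact n * Gamma (v + real n + 1)) * (x / 2) powr (2 * real n + v))"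

definition hyp1F1 :: "complex \<Rightarrow> complex \<Rightarrow> complex \<Rightarrow> complex" where
  "hyp1F1 a b x = (\<Sum>k. pochhammer a k / pochhammer b k * x ^ k / fact k)"

definition whittaker_M :: "complex \<Rightarrow> complex \<Rightarrow> complex \<Rightarrow> complex" where
  "whittaker_M \<mu> v x =
     x powr (v + 1/2) * exp (- x / 2) * hyp1F1 (v - \<mu> + 1/2) (2 * v + 1) x"

definition mellin_converges :: "(real \<Rightarrow> complex) \<Rightarrow> complex \<Rightarrow> bool" where
  "mellin_converges g s \<longleftrightarrow> (\<lambda>y. of_real y powr (s - 1) * g y) integrable_on {0<..}"

definition mellin :: "(real \<Rightarrow> complex) \<Rightarrow> complex \<Rightarrow> complex" where
  "mellin g s = integral {0<..} (\<lambda>y. of_real y powr (s - 1) * g y)"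

definition diffusion_integrand ::
    "real \<Rightarrow> (real \<Rightarrow> complex) \<Rightarrow> real \<Rightarrow> real \<Rightarrow> real \<Rightarrow> complex" where
  "diffusion_integrand \<kappa> g r t y =
     of_real y * g y * of_real (bessel_I 0 (y * r / (2 * \<kappa> * t)))
       * of_real (exp (- (y\<^sup>2) / (4 * \<kappa> * t)))"

text \<open>The solution of \<open>\<kappa> (u_rr + u_r / r) = u_t\<close> with initial data \<open>u(r,0) = g(r)\<close>.\<close>
definition diffusion_solution ::
    "real \<Rightarrow> (real \<Rightarrow> complex) \<Rightarrow> real \<Rightarrow> real \<Rightarrow> complex" where
  "diffusion_solution \<kappa> g r t =
     of_real (1 / (2 * \<kappa> * t) * exp (- (r\<^sup>2) / (4 * \<kappa> * t)))
       * integral {0<..} (diffusion_integrand \<kappa> g r t)"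

text \<open>
  Integration along the upward vertical line \<open>s = c + \<i> \<tau>\<close>, so that \<open>ds = \<i> d\<tau>\<close>.
\<close>
definition vertical_integrable :: "complex \<Rightarrow> (complex \<Rightarrow> complex) \<Rightarrow> bool" where
  "vertical_integrable c f \<longleftrightarrow> (\<lambda>\<tau>::real. f (c + \<i> * of_real \<tau>)) integrable_on UNIV"

definition vertical_integral :: "complex \<Rightarrow> (complex \<Rightarrow> complex) \<Rightarrow> complex" where
  "vertical_integral c f = \<i> * integral UNIV (\<lambda>\<tau>::real. f (c + \<i> * of_real \<tau>))"

definition inversion_integrand ::
    "real \<Rightarrow> (real \<Rightarrow> complex) \<Rightarrow> real \<Rightarrow> real \<Rightarrow> complex \<Rightarrow> complex" where
  "inversion_integrand \<kappa> g r t s =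
     Gamma (s / 2 + 1 / 2) * of_real (4 * \<kappa> * t) powr (s / 2)
       * whittaker_M (- s / 2) 0 (of_real (r\<^sup>2 / (4 * \<kappa> * t))) * mellin g (1 - s)"

end

theory Submission
  imports Defs "HOL-Probability.Levy"
begin

text \<open>
  Write \<open>A = 4\<kappa>t\<close>, \<open>q = r\<^sup>2/A\<close> and \<open>z = (s + 1)/2\<close>. Since \<open>\<Gamma>(z) 1F1(z; 1; q) = \<Sum>\<^sub>n \<Gamma>(z + n) q\<^sup>n / n!\<^sup>2\<close>,
  integrating the Cahen--Mellin formula termwise shows that the inverse Mellin transform of the
  factor in front of \<open>M(g)(1 - s)\<close> is, up to constants, \<open>y exp(-y\<^sup>2/A) I\<^sub>0(yr/(2\<kappa>t))\<close>. The theorem is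
  then Parseval's formula for Mellin transforms.

  The Mellin integral of \<open>g\<close> may converge only conditionally, so Parseval's formula is not plain
  Fubini. Convergence at \<open>c - \<delta>\<close> and \<open>c + \<delta>\<close> makes \<open>w(y) = (y\<^sup>\<delta> + y\<^sup>-\<^sup>\<delta>) y\<^sup>-\<^sup>c g(y)\<close> Henstock--Kurzweil
  integrable. Integrating by parts against the bounded primitive of \<open>w\<close> gives absolutely convergent
  integrals, at the price of a factor \<open>\<bar>\<tau>\<bar>\<close>, which the decay of \<open>\<Gamma>\<close> on vertical lines
  absorbs; polynomial decay, from the functional equation, suffices.
\<close>

text \<open>When the Mellin integral of \<open>g\<close> converges only conditionally, estimating
  its integrand says nothing about its size on a vertical line; integration by parts bounds it by a
  multiple of \<bar>\<tau>\<bar> + 1. The other factor has to beat this growth, and the vertical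
  integral then converges absolutely. The obstacle to integrating by parts is that the derivative of
  y powr (-i\<tau>) has modulus \<bar>\<tau>\<bar>/y, which is integrable neither at 0 nor at
  infinity. Convergence at one neighbouring point repairs only one of the two ends; hence both c -
  \<delta> and c + \<delta> are used, and c has to be interior to the set of convergence. The
  Cahen-Mellin formula is treated as Fourier inversion: on a vertical line \<Gamma> is, up to a
  constant, a characteristic function, so Levy's inversion theorem replaces the calculus of
  residues.\<close>

subsection \<open>Fubini for conditionally convergent integrals\<close>

text \<open>
  A Fubini theorem in which \<open>w\<close> need not be absolutely integrable: the restrictions of \<open>w\<close> to the
  half-lines \<open>{v..}\<close> are equiintegrable, so one gauge makes all their Riemann sums close to their
  integrals, and these estimates can be averaged against \<open>p v dv\<close>.
\<close>
lemma has_integral_mult_indefinite_integral: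
  fixes w p :: "real \<Rightarrow> complex"
  assumes w: "w integrable_on {a..b}" and p: "integrable lborel p"
    and meas: "(\<lambda>v. integral {a..b} (\<lambda>x. if v \<le> x then w x else 0)) \<in> borel_measurable borel"
    and bdd: "\<And>v. norm (integral {a..b} (\<lambda>x. if v \<le> x then w x else 0)) \<le> B"
  shows "((\<lambda>x. w x * (LINT v|lborel. indicator {..x} v *\<^sub>R p v)) has_integral
           (LINT v|lborel. p v * integral {a..b} (\<lambda>x. if v \<le> x then w x else 0))) {a..b}"
proof -
  define V where "V v = integral {a..b} (\<lambda>x. if v \<le> x then w x else 0)" for v
  define P where "P x = (LINT v|lborel. indicator {..x} v *\<^sub>R p v)" for x
  define N where "N = (LINT v|lborel. norm (p v))"
  have N: "0 \<le> N" unfolding N_def by simp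
  have "{w} equiintegrable_on cbox a b"
    using w by (metis box_real(2) equiintegrable_on_sing)
  then have "(\<Union>i\<in>Basis. \<Union>c. \<Union>h\<in>{w}. {\<lambda>x::real. if x \<bullet> i \<ge> c then h x else 0}) equiintegrable_on cbox a b"
    by (rule equiintegrable_halfspace_restrictions_ge[of _ _ _ w]) auto
  then have equi: "(\<Union>c. {\<lambda>x. if c \<le> x then w x else 0}) equiintegrable_on cbox a b"
    by simp
  have pV: "integrable lborel (\<lambda>v. p v * V v)"
  proof (rule Bochner_Integration.integrable_bound)
    show "integrable lborel (\<lambda>v. B *\<^sub>R p v)" using p by simp
    show "(\<lambda>v. p v * V v) \<in> borel_measurable lborel"
      using p meas unfolding V_def by simp
    have "norm (p v * V v) \<le> norm (B *\<^sub>R p v)" for v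
    proof -
      have "norm (V v) \<le> \<bar>B\<bar>" using bdd[of v] unfolding V_def by linarith
      then show ?thesis
        by (simp add: norm_mult mult.commute[of "norm (p v)"] mult_right_mono)
    qed
    then show "AE v in lborel. norm (p v * V v) \<le> norm (B *\<^sub>R p v)" by simp
  qed
  have ip: "integrable lborel (\<lambda>v. indicator {..x} v *\<^sub>R p v)" for x :: real
    using p by (intro integrable_mult_indicator) auto
  have "((\<lambda>x. w x * P x) has_integral (LINT v|lborel. p v * V v)) (cbox a b)"
    unfolding has_integral
  proof (intro allI impI)
    fix e :: real assume e: "e > 0"
    \<comment> \<open>The averaged error is at most \<open>N * d\<close>; the 1 in the denominator
      covers \<open>N = 0\<close>.\<close>
    define d where "d = e / (N + 1)"
    have d: "d > 0" "N * d < e" using e N by (auto simp: d_def field_simps)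
    obtain \<gamma> where \<gamma>: "gauge \<gamma>"
      and fine: "\<And>f D. \<lbrakk>f \<in> (\<Union>c. {\<lambda>x. if c \<le> x then w x else 0}); D tagged_division_of cbox a b; \<gamma> fine D\<rbrakk>
        \<Longrightarrow> norm ((\<Sum>(x,K)\<in>D. measure lborel K *\<^sub>R f x) - integral (cbox a b) f) < d"
      using equi d unfolding equiintegrable_on_def by meson
    show "\<exists>\<gamma>. gauge \<gamma> \<and> (\<forall>\<D>. \<D> tagged_division_of cbox a b \<and> \<gamma> fine \<D> \<longrightarrow>
        norm ((\<Sum>(x, K)\<in>\<D>. measure lborel K *\<^sub>R (w x * P x)) - (LINT v|lborel. p v * V v)) < e)"
    proof (intro exI[of _ \<gamma>] conjI allI impI \<gamma>)
      fix D assume D: "D tagged_division_of cbox a b \<and> \<gamma> fine D"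
      \<comment> \<open>Integrated against \<open>p\<close>, this Riemann sum of the cut-off
        \<open>w\<close> becomes the Riemann sum of \<open>w x * P x\<close>, because
        \<open>P x\<close> integrates \<open>p\<close> over exactly those v with v \<le> x.\<close>
      define R where "R v = (\<Sum>(x,K)\<in>D. measure lborel K *\<^sub>R (if v \<le> x then w x else 0))" for v
      have RV: "norm (R v - V v) < d" for v
        using fine[of "\<lambda>x. if v \<le> x then w x else 0" D] D unfolding R_def V_def by auto
      have pR_eq: "p v * R v = (\<Sum>xK\<in>D. (measure lborel (snd xK) *\<^sub>R w (fst xK)) * (indicator {..fst xK} v *\<^sub>R p v))" for v
        unfolding R_def sum_distrib_left by (rule sum.cong) (auto simp: indicator_def)
      have pR: "integrable lborel (\<lambda>v. p v * R v)"
        unfolding pR_eq by (intro Bochner_Integration.integrable_sum integrable_mult_right ip)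
      have "(LINT v|lborel. p v * R v) = (\<Sum>xK\<in>D. (measure lborel (snd xK) *\<^sub>R w (fst xK)) * P (fst xK))"
        unfolding pR_eq P_def
        by (subst Bochner_Integration.integral_sum)
           (intro integrable_mult_right ip, simp only: integral_mult_right_zero)
      also have "\<dots> = (\<Sum>(x, K)\<in>D. measure lborel K *\<^sub>R (w x * P x))"
        by (rule sum.cong) auto
      finally have "(\<Sum>(x, K)\<in>D. measure lborel K *\<^sub>R (w x * P x)) - (LINT v|lborel. p v * V v)
          = (LINT v|lborel. p v * (R v - V v))"
        using pR pV by (simp add: right_diff_distrib)
      also have "norm \<dots> \<le> (LINT v|lborel. norm (p v) * d)"
      proof (rule order_trans[OF integral_norm_bound], rule Bochner_Integration.integral_mono)
        show "integrable lborel (\<lambda>v. norm (p v * (R v - V v)))"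
          using pR pV by (simp add: right_diff_distrib)
        show "integrable lborel (\<lambda>v. norm (p v) * d)" using p by simp
        show "norm (p v * (R v - V v)) \<le> norm (p v) * d" for v
          using RV[of v] by (auto simp: norm_mult intro!: mult_left_mono)
      qed
      also have "\<dots> = N * d" unfolding N_def by simp
      finally show "norm ((\<Sum>(x, K)\<in>D. measure lborel K *\<^sub>R (w x * P x)) - (LINT v|lborel. p v * V v)) < e"
        using d by simp
    qed
  qed
  then show ?thesis unfolding V_def P_def by simp
qed

text \<open>\<open>has_integral_alt'\<close> quantifies over all intervals that contain a large
  ball; as \<open>f0\<close> vanishes on the negative axis, only the upper endpoint matters. No
  limit is taken at 0, since gauge integrability on \<open>{0..b}\<close> already covers a
  singularity there.\<close>

lemma has_integral_Ioi_iff: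
  fixes f :: "real \<Rightarrow> 'a::banach"
  defines "f0 \<equiv> \<lambda>x. if 0 < x then f x else 0"
  shows "(f has_integral i) {0<..} \<longleftrightarrow>
     (\<forall>b\<ge>0. f0 integrable_on {0..b}) \<and> ((\<lambda>b. integral {0..b} f0) \<longlongrightarrow> i) at_top" (is "_ \<longleftrightarrow> ?r")
proof -
  have f0: "(\<lambda>x. if x \<in> {0<..} then f x else 0) = f0" by (auto simp: f0_def)
  have cut: "f0 integrable_on {a..b} \<and> integral {a..b} f0 = integral {0..b} f0"
    if "f0 integrable_on {0..b}" "a \<le> 0" for a b
  proof -
    have "(f0 has_integral integral {0..b} f0) {0..b}" using that by blast
    then have "(f0 has_integral integral {0..b} f0) {a..b}"
      using that
      by (subst (asm) has_integral_restrict[symmetric, of _ "{a..b}"])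
         (auto simp: f0_def elim!: has_integral_eq[rotated])
    then show ?thesis by (simp add: has_integral_iff)
  qed
  show ?thesis
  proof
    assume L: "(f has_integral i) {0<..}"
    then have 1: "\<And>a b. f0 integrable_on {a..b}"
      and 2: "\<And>e. e > 0 \<Longrightarrow> \<exists>B>0. \<forall>a b. ball 0 B \<subseteq> {a..b} \<longrightarrow> norm (integral {a..b} f0 - i) < e"
      unfolding has_integral_alt' f0 box_real by blast+
    have "((\<lambda>b. integral {0..b} f0) \<longlongrightarrow> i) at_top"
    proof (rule tendstoI)
      fix e :: real assume "e > 0"
      then obtain B where B: "B > 0" "\<And>a b. ball 0 B \<subseteq> {a..b} \<Longrightarrow> norm (integral {a..b} f0 - i) < e"
        using 2 by blast
      show "\<forall>\<^sub>F b in at_top. dist (integral {0..b} f0) i < e"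
        using eventually_ge_at_top[of B]
      proof eventually_elim
        case (elim b)
        have "ball 0 B \<subseteq> {-B..b}" using elim by (auto simp: dist_real_def)
        from B(2)[OF this] show ?case
          using cut[OF 1, of "-B" b] B(1) by (simp add: dist_norm)
      qed
    qed
    with 1 show ?r by blast
  next
    assume R: ?r
    have I: "f0 integrable_on {a..b}" for a b
    proof (cases "b \<ge> 0")
      case True
      then have "f0 integrable_on {min a 0..b}" using R cut[of b "min a 0"] by auto
      then show ?thesis by (rule integrable_on_subinterval) auto
    next
      case False
      then show ?thesis
        by (intro integrable_eq[OF integrable_0]) (auto simp: f0_def)
    qed
    show "(f has_integral i) {0<..}"
      unfolding has_integral_alt' f0
    proof (intro conjI allI impI)
      show "f0 integrable_on cbox a b" for a b using I by simp
      fix e :: real assume "e > 0"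
      then have "\<forall>\<^sub>F b in at_top. dist (integral {0..b} f0) i < e"
        using R by (auto dest: tendstoD)
      then obtain B0 where B0: "\<And>b. b \<ge> B0 \<Longrightarrow> dist (integral {0..b} f0) i < e"
        by (auto simp: eventually_at_top_linorder)
      define B where "B = max B0 1"
      show "\<exists>B>0. \<forall>a b. ball 0 B \<subseteq> cbox a b \<longrightarrow> norm (integral (cbox a b) f0 - i) < e"
      proof (intro exI[of _ B] conjI allI impI)
        show "B > 0" by (simp add: B_def)
        fix a b :: real assume sub: "ball 0 B \<subseteq> cbox a b"
        have "0 \<in> ball (0::real) B" using \<open>B > 0\<close> by simp
        then have "0 \<in> cbox a b" using sub by blast
        then have "a \<le> 0" by simp
        moreover have "b \<ge> B"
        proof (rule ccontr)
          assume "\<not> b \<ge> B"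
          then have "(b + B)/2 \<in> ball 0 B"
            using \<open>B > 0\<close> \<open>0 \<in> cbox a b\<close> by (simp add: dist_real_def)
          then have "(b + B)/2 \<in> cbox a b" using sub by blast
          then have "(b+B)/2 \<le> b" by simp
          then show False using \<open>\<not> b \<ge> B\<close> by simp
        qed
        ultimately show "norm (integral (cbox a b) f0 - i) < e"
          using B0[of b] cut[OF I, of a b] by (simp add: B_def dist_norm)
      qed
    qed
  qed
qed

text \<open>Integration by parts on the half-line. On \<open>{0..b}\<close> it is the preceding
  Fubini theorem, and b tends to infinity by dominated convergence: \<open>W\<close> is continuous
  with a limit at infinity, hence bounded, and \<open>norm (p v)\<close> times a constant
  dominates.\<close>

lemma has_integral_Ioi_mult_indefinite_integral:
  fixes w p :: "real \<Rightarrow> complex"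
  assumes w: "w integrable_on {0<..}" and p: "integrable lborel p"
  defines "W \<equiv> \<lambda>v. integral {0..v} (\<lambda>x. if 0 < x then w x else 0)"
  shows "((\<lambda>x. w x * (LINT v|lborel. indicator {..x} v *\<^sub>R p v)) has_integral
           (LINT v|lborel. p v * (integral {0<..} w - W v))) {0<..}" (is ?has)
    and "continuous_on UNIV W" (is ?cont)
    and "bounded (range W)" (is ?bdd)
proof -
  define w0 where "w0 x = (if 0 < x then w x else 0)" for x
  define L where "L = integral {0<..} w"
  have W_def: "W v = integral {0..v} w0" for v
    unfolding W_def w0_def ..
  have lim: "(W \<longlongrightarrow> L) at_top" and w0: "w0 integrable_on {0..b}" for b
  proof -
    have "(w has_integral L) {0<..}" using w by (auto simp: L_def)
    then have *: "\<forall>b\<ge>0. w0 integrable_on {0..b}" and "((\<lambda>b. integral {0..b} w0) \<longlongrightarrow> L) at_top"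
      unfolding has_integral_Ioi_iff w0_def by auto
    then show "(W \<longlongrightarrow> L) at_top" unfolding W_def by simp
    show "w0 integrable_on {0..b}"
      using * by (cases "b \<ge> 0") auto
  qed
  have Wneg: "W v = 0" if "v \<le> 0" for v
    using that by (cases "v = 0") (auto simp: W_def)
  have contb: "continuous_on {0..b} W" for b
    unfolding W_def by (rule indefinite_integral_continuous_1[OF w0])
  have cont0: "continuous_on {0..} W"
    unfolding continuous_on_eq_continuous_within
  proof
    fix x :: real assume "x \<in> {0..}"
    then have "continuous (at x within {0..x+1}) W"
      using contb[of "x+1"] by (auto simp: continuous_on_eq_continuous_within)
    moreover have "at x within {0..} = at x within {0..x+1}"
      by (rule at_within_nhd[of _ "{..<x+1}"]) auto
    ultimately show "continuous (at x within {0..}) W" by simp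
  qed
  \<comment> \<open>\<open>W\<close> is zero to the left of 0, so composing with
    \<open>max 0\<close> extends continuity and boundedness from the half-line to the whole
    line.\<close>
  have Wmax: "W = (\<lambda>v. W (max 0 v))"
    using Wneg by (auto simp: max_def)
  show ?cont
    by (subst Wmax, rule continuous_on_compose2[OF cont0]) (auto intro!: continuous_intros)
  obtain B0 where B0: "\<And>v. v \<ge> B0 \<Longrightarrow> dist (W v) L < 1"
    using tendstoD[OF lim zero_less_one] by (auto simp: eventually_at_top_linorder)
  have "bounded (W ` {0..max 0 B0})"
    by (intro compact_imp_bounded compact_continuous_image contb compact_Icc)
  moreover have "bounded (ball L 1)" by simp
  moreover have "range W \<subseteq> W ` {0..max 0 B0} \<union> ball L 1"
  proof
    fix z assume "z \<in> range W"
    then obtain v where v: "z = W (max 0 v)" using Wmax by (metis imageE)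
    show "z \<in> W ` {0..max 0 B0} \<union> ball L 1"
    proof (cases "max 0 v \<ge> B0")
      case True
      then show ?thesis using B0[of "max 0 v"] by (simp add: v dist_commute)
    next
      case False
      then show ?thesis unfolding v by (intro UnI1 imageI) auto
    qed
  qed
  ultimately show ?bdd by (metis bounded_Un bounded_subset)
  then obtain C where C: "\<And>v. norm (W v) \<le> C"
    by (auto simp: bounded_iff)
  define V where "V b v = integral {0..b} (\<lambda>x. if v \<le> x then w0 x else 0)" for b v
  \<comment> \<open>The minimum covers v > b, where the cut-off leaves nothing to integrate; v \<le>
    0 is covered by \<open>W v = 0\<close>.\<close>
  have V: "V b v = W b - W (min v b)" if b: "b \<ge> 0" for b v
  proof -
    consider "v \<le> 0" | "0 < v" "v \<le> b" | "v > b" by linarith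
    then show ?thesis
    proof cases
      case 1
      then have "V b v = integral {0..b} w0"
        unfolding V_def by (intro integral_cong) auto
      then show ?thesis using 1 b by (simp add: W_def[symmetric] Wneg min_def)
    next
      case 2
      have "V b v = integral {v..b} w0"
      proof -
        have "w0 integrable_on {v..b}"
          by (rule integrable_subinterval_real[OF w0[of b]]) (use 2 in auto)
        then have "((\<lambda>x. if x \<in> {v..b} then w0 x else 0) has_integral integral {v..b} w0) {0..b}"
          using 2 by (subst has_integral_restrict) auto
        then have "((\<lambda>x. if v \<le> x then w0 x else 0) has_integral integral {v..b} w0) {0..b}"
          by (rule has_integral_eq[rotated]) auto
        then show ?thesis unfolding V_def by (rule integral_unique)
      qed
      moreover have "W v + integral {v..b} w0 = W b"
        unfolding W_def using 2 by (intro Henstock_Kurzweil_Integration.integral_combine w0) auto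
      ultimately show ?thesis using 2 by (simp add: min_def algebra_simps)
    next
      case 3
      then have "V b v = integral {0..b} (\<lambda>x. 0)"
        unfolding V_def by (intro integral_cong) auto
      then show ?thesis using 3 by (simp add: min_def)
    qed
  qed
  have [measurable]: "W \<in> borel_measurable borel"
    using \<open>?cont\<close> by (rule borel_measurable_continuous_onI)
  have [measurable]: "p \<in> borel_measurable borel"
    using borel_measurable_integrable[OF p] by simp
  have measV: "(\<lambda>v. W b - W (min v b)) \<in> borel_measurable borel" for b
    by measurable
  have Vbdd: "norm (W b - W (min v b)) \<le> 2 * C" for b v
    using norm_triangle_ineq4[of "W b" "W (min v b)"] C[of b] C[of "min v b"] by simp
  define P where "P x = (LINT v|lborel. indicator {..x} v *\<^sub>R p v)" for x
  have fin: "((\<lambda>x. w0 x * P x) has_integral (LINT v|lborel. p v * (W b - W (min v b)))) {0..b}"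
    if "b \<ge> 0" for b
    using has_integral_mult_indefinite_integral[OF w0[of b] p, of "2 * C"] measV Vbdd that
    unfolding V_def[symmetric] P_def V[OF that] by simp
  have lim2: "((\<lambda>b. LINT v|lborel. p v * (W b - W (min v b))) \<longlongrightarrow> (LINT v|lborel. p v * (L - W v))) at_top"
  proof (rule integral_dominated_convergence_at_top[where w = "\<lambda>v. norm (p v) * (2 * C)"])
    show "(\<lambda>v. p v * (L - W v)) \<in> borel_measurable lborel"
      by measurable
    show "(\<lambda>v. p v * (W b - W (min v b))) \<in> borel_measurable lborel" for b
      by measurable
    show "integrable lborel (\<lambda>v. norm (p v) * (2 * C))" using p by simp
    show "\<forall>\<^sub>F b in at_top. AE v in lborel. norm (p v * (W b - W (min v b))) \<le> norm (p v) * (2 * C)"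
      using Vbdd by (intro always_eventually allI AE_I2) (auto simp: norm_mult intro!: mult_left_mono)
    have "((\<lambda>b. p v * (W b - W (min v b))) \<longlongrightarrow> p v * (L - W v)) at_top" for v
    proof -
      have "((\<lambda>b. W (min v b)) \<longlongrightarrow> W v) at_top"
        by (rule tendsto_eventually, rule eventually_mono[OF eventually_ge_at_top[of v]]) (auto simp: min_def)
      then show ?thesis by (intro tendsto_intros lim)
    qed
    then show "AE v in lborel. ((\<lambda>b. p v * (W b - W (min v b))) \<longlongrightarrow> p v * (L - W v)) at_top" by simp
  qed
  have eq: "(\<lambda>x. if 0 < x then w x * P x else 0) = (\<lambda>x. w0 x * P x)"
    by (auto simp: w0_def)
  have "((\<lambda>x. w x * P x) has_integral (LINT v|lborel. p v * (L - W v))) {0<..}"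
    unfolding has_integral_Ioi_iff eq
  proof (intro conjI allI impI)
    show "(\<lambda>x. w0 x * P x) integrable_on {0..b}" if "0 \<le> b" for b
      using fin[OF that] by blast
    show "((\<lambda>b. integral {0..b} (\<lambda>x. w0 x * P x)) \<longlongrightarrow> (LINT v|lborel. p v * (L - W v))) at_top"
      using lim2
    proof (rule Lim_transform_eventually)
      show "\<forall>\<^sub>F b in at_top. (LINT v|lborel. p v * (W b - W (min v b))) = integral {0..b} (\<lambda>x. w0 x * P x)"
        using eventually_ge_at_top[of 0] by eventually_elim (use fin in \<open>simp add: has_integral_iff\<close>)
    qed
  qed
  then show ?has by (simp add: P_def L_def)
qed

text \<open>Integration by parts is applied twice: for each fixed \<tau> with density
  \<open>k \<tau>\<close>, and once with the \<tau>-average of these densities. Both right-hand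
  sides are integrals against the bounded function \<open>V\<close>, so ordinary Fubini for
  \<open>F \<tau> * k \<tau> v\<close> identifies them; \<open>w\<close> itself never enters a
  double integral.\<close>

lemma has_integral_Ioi_mult_parametric_integral:
  fixes w F :: "real \<Rightarrow> complex" and k E :: "real \<Rightarrow> real \<Rightarrow> complex"
  assumes w: "w integrable_on {0<..}"
    and int: "integrable (lborel \<Otimes>\<^sub>M lborel) (\<lambda>(\<tau>, v). F \<tau> * k \<tau> v)"
    and k: "\<And>\<tau>. integrable lborel (k \<tau>)"
    and E: "\<And>\<tau> x. 0 < x \<Longrightarrow> E \<tau> x = (LINT v|lborel. indicator {..x} v *\<^sub>R k \<tau> v)"
  shows "\<And>\<tau>. (\<lambda>x. w x * E \<tau> x) integrable_on {0<..}" (is "\<And>\<tau>. ?int \<tau>")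
    and "integrable lborel (\<lambda>\<tau>. F \<tau> * integral {0<..} (\<lambda>x. w x * E \<tau> x))" (is ?Fint)
    and "((\<lambda>x. w x * (LINT \<tau>|lborel. F \<tau> * E \<tau> x)) has_integral
           (LINT \<tau>|lborel. F \<tau> * integral {0<..} (\<lambda>x. w x * E \<tau> x))) {0<..}" (is ?has)
proof -
  \<comment> \<open>The tail integral of \<open>w\<close> from v to infinity.\<close>
  define V where "V v = integral {0<..} w - integral {0..v} (\<lambda>x. if 0 < x then w x else 0)" for v
  note L2 = has_integral_Ioi_mult_indefinite_integral[OF w, folded V_def]
  \<comment> \<open>The zero function serves as density where only continuity or boundedness of the
    primitive is wanted.\<close>
  have p0: "integrable lborel (\<lambda>_::real. 0::complex)" by simp
  have [measurable]: "V \<in> borel_measurable borel"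
    unfolding V_def
    by (intro borel_measurable_continuous_onI continuous_on_diff continuous_on_const L2(2)[OF p0])
  obtain C where C: "\<And>v. norm (integral {0..v} (\<lambda>x. if 0 < x then w x else 0)) \<le> C"
    using L2(3)[OF p0] by (auto simp: bounded_iff)
  have VC: "norm (V v) \<le> norm (integral {0<..} w) + C" for v
    unfolding V_def by (rule order_trans[OF norm_triangle_ineq4]) (simp add: C)
  define m where "m \<tau> = (LINT v|lborel. k \<tau> v * V v)" for \<tau>
  have hm: "((\<lambda>x. w x * E \<tau> x) has_integral m \<tau>) {0<..}" for \<tau>
    by (rule has_integral_eq[OF _ L2(1)[OF k[of \<tau>], folded m_def]]) (simp add: E)
  then show "?int \<tau>" for \<tau> by blast
  have mi: "integral {0<..} (\<lambda>x. w x * E \<tau> x) = m \<tau>" for \<tau>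
    using hm by (rule integral_unique)
  have meas [measurable]: "(\<lambda>(\<tau>, v). F \<tau> * k \<tau> v) \<in> borel_measurable (lborel \<Otimes>\<^sub>M lborel)"
    using int by (rule borel_measurable_integrable)
  have FkV: "integrable (lborel \<Otimes>\<^sub>M lborel) (\<lambda>(\<tau>, v). F \<tau> * k \<tau> v * V v)"
  proof (rule Bochner_Integration.integrable_bound)
    show "integrable (lborel \<Otimes>\<^sub>M lborel) (\<lambda>z. (norm (integral {0<..} w) + C) *\<^sub>R (case z of (\<tau>, v) \<Rightarrow> F \<tau> * k \<tau> v))"
      using int by (intro integrable_scaleR_right)
    have "(\<lambda>z. (case z of (\<tau>, v) \<Rightarrow> F \<tau> * k \<tau> v) * V (snd z)) \<in> borel_measurable (lborel \<Otimes>\<^sub>M lborel)"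
      by measurable
    then show "(\<lambda>(\<tau>, v). F \<tau> * k \<tau> v * V v) \<in> borel_measurable (lborel \<Otimes>\<^sub>M lborel)"
      by (simp add: case_prod_beta')
    have "norm (F \<tau> * k \<tau> v * V v) \<le> norm ((norm (integral {0<..} w) + C) *\<^sub>R (F \<tau> * k \<tau> v))" for \<tau> v
    proof -
      have "norm (V v) \<le> \<bar>norm (integral {0<..} w) + C\<bar>" using VC[of v] by linarith
      then show ?thesis
        by (simp add: norm_mult mult.commute[of _ "norm (V v)"] mult_right_mono)
    qed
    then show "AE z in lborel \<Otimes>\<^sub>M lborel. norm (case z of (\<tau>, v) \<Rightarrow> F \<tau> * k \<tau> v * V v)
        \<le> norm ((norm (integral {0<..} w) + C) *\<^sub>R (case z of (\<tau>, v) \<Rightarrow> F \<tau> * k \<tau> v))"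
      by (intro AE_I2) auto
  qed
  have Fm: "F \<tau> * m \<tau> = (LINT v|lborel. F \<tau> * k \<tau> v * V v)" for \<tau>
    unfolding m_def by (simp add: mult.assoc)
  show ?Fint
    unfolding mi Fm using lborel_pair.integrable_fst[OF FkV] .
  define p where "p v = (LINT \<tau>|lborel. F \<tau> * k \<tau> v)" for v
  have p: "integrable lborel p"
    unfolding p_def using lborel_pair.integrable_snd[OF int] .
  have "(LINT v|lborel. p v * V v) = (LINT v|lborel. LINT \<tau>|lborel. F \<tau> * k \<tau> v * V v)"
    unfolding p_def by simp
  also have "\<dots> = (LINT \<tau>|lborel. F \<tau> * m \<tau>)"
    unfolding Fm by (rule lborel_pair.Fubini_integral[OF FkV])
  finally have eq1: "(LINT v|lborel. p v * V v) = (LINT \<tau>|lborel. F \<tau> * m \<tau>)" .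
  have eq2: "(LINT v|lborel. indicator {..x} v *\<^sub>R p v) = (LINT \<tau>|lborel. F \<tau> * E \<tau> x)" if "0 < x" for x
  proof -
    have "integrable (lborel \<Otimes>\<^sub>M lborel) (\<lambda>z. indicator (UNIV \<times> {..x}) z *\<^sub>R (case z of (\<tau>, v) \<Rightarrow> F \<tau> * k \<tau> v))"
      by (rule integrable_mult_indicator[OF _ int])
         (simp add: pair_measureI)
    then have i: "integrable (lborel \<Otimes>\<^sub>M lborel) (\<lambda>(\<tau>, v). indicator {..x} v *\<^sub>R (F \<tau> * k \<tau> v))"
      by (rule Bochner_Integration.integrable_cong[THEN iffD1, rotated 2]) (auto simp: indicator_def)
    have "(LINT v|lborel. indicator {..x} v *\<^sub>R p v)
        = (LINT v|lborel. LINT \<tau>|lborel. indicator {..x} v *\<^sub>R (F \<tau> * k \<tau> v))"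
      unfolding p_def by simp
    also have "\<dots> = (LINT \<tau>|lborel. LINT v|lborel. indicator {..x} v *\<^sub>R (F \<tau> * k \<tau> v))"
      by (rule lborel_pair.Fubini_integral[OF i])
    also have "\<dots> = (LINT \<tau>|lborel. F \<tau> * E \<tau> x)"
      by (simp add: E[OF that] mult_scaleR_right[symmetric] del: mult_scaleR_right)
    finally show ?thesis .
  qed
  show ?has
    unfolding mi by (rule has_integral_eq[OF _ L2(1)[OF p, unfolded eq1]]) (simp add: eq2)
qed

subsection \<open>The Cahen--Mellin integral\<close>

lemma norm_Gamma_le:
  assumes "Re z > 0"
  shows "norm (Gamma z) \<le> Gamma (Re z)"
proof -
  have c: "((\<lambda>t. of_real t powr (z - 1) / of_real (exp t)) has_integral Gamma z) {0..}"
    using assms by (rule Gamma_integral_complex)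
  have r: "((\<lambda>t. t powr (Re z - 1) / exp t) has_integral Gamma (Re z)) {0..}"
    using assms by (rule Gamma_integral_real)
  have "norm (integral {0..} (\<lambda>t. complex_of_real t powr (z - 1) / of_real (exp t)))
      \<le> integral {0..} (\<lambda>t. t powr (Re z - 1) / exp t)"
  proof (rule Henstock_Kurzweil_Integration.integral_norm_bound_integral)
    show "norm (complex_of_real t powr (z - 1) / of_real (exp t)) \<le> t powr (Re z - 1) / exp t"
      if "t \<in> {0..}" for t
      using that by (simp add: norm_divide norm_powr_real_powr del: of_real_exp)
  qed (use c r in blast)+
  then show ?thesis
    using c r by (simp add: integral_unique)
qed

lemma norm_le_norm_add_nat:
  fixes z :: complex
  assumes "Re z \<ge> 0"
  shows "norm z \<le> norm (z + of_nat k)"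
  unfolding cmod_def using assms by (intro real_sqrt_le_mono) (auto intro!: power_mono)

lemma norm_power_le_pochhammer:
  fixes z :: complex
  assumes "Re z \<ge> 0"
  shows "norm z ^ k \<le> norm (pochhammer z k)"
proof (induction k)
  case (Suc k)
  with norm_le_norm_add_nat[OF assms, of k] show ?case
    by (simp add: pochhammer_Suc norm_mult mult.commute[of "norm z"] mult_mono)
qed simp

text \<open>By the functional equation \<open>Gamma (z + k)\<close> is \<open>Gamma z\<close> times
  a product of k factors z + j, and in the right half-plane each of them has modulus at least that
  of z.\<close>

lemma norm_Gamma_le_power:
  assumes "Re z > 0"
  shows "norm (Gamma z) \<le> Gamma (Re z + real k) / norm z ^ k"
proof -
  have z: "z \<notin> \<int>\<^sub>\<le>\<^sub>0" using assms by (auto elim!: nonpos_Ints_cases)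
  then have "Gamma z \<noteq> 0" by (simp add: Gamma_eq_zero_iff)
  then have "norm z ^ k * norm (Gamma z) \<le> norm (Gamma (z + of_nat k))"
    using mult_right_mono[OF norm_power_le_pochhammer[of z k] norm_ge_zero[of "Gamma z"]] assms
      pochhammer_Gamma[OF z, of k] by (simp add: norm_mult norm_divide)
  also have "\<dots> \<le> Gamma (Re z + real k)"
    using norm_Gamma_le[of "z + of_nat k"] assms by simp
  finally show ?thesis
    using assms by (subst pos_le_divide_eq) (auto simp: mult.commute intro!: zero_less_power)
qed

text \<open>The dominating function for the vertical integrals below; an affine substitution reduces
  it to \<open>inverse (1 + x^2)\<close>.\<close>

lemma integrable_inverse_norm_square_vertical:
  fixes z :: complex and \<beta> :: real
  assumes "Re z > 0" "\<beta> \<noteq> 0"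
  shows "integrable lborel (\<lambda>\<tau>. 1 / norm (z + \<i> * of_real (\<beta> * \<tau>)) ^ 2)"
proof -
  let ?a = "Re z" and ?b = "Im z"
  have "integrable lborel (\<lambda>x::real. inverse (1 + x^2))"
    using integrable_inverse_1_plus_square by (simp add: set_integrable_def)
  then have "integrable lborel (\<lambda>x::real. inverse (1 + (?b/?a + (\<beta>/?a) * x)^2))"
    using assms by (intro lborel_integrable_real_affine) auto
  then have "integrable lborel (\<lambda>x::real. 1/?a^2 * inverse (1 + (?b/?a + (\<beta>/?a) * x)^2))"
    by simp
  moreover have "1/?a^2 * inverse (1 + (?b/?a + (\<beta>/?a) * x)^2) = 1 / norm (z + \<i> * of_real (\<beta> * x)) ^ 2" for x
  proof -
    have "norm (z + \<i> * of_real (\<beta> * x)) ^ 2 = ?a^2 + (?b + \<beta> * x)^2"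
      by (simp add: cmod_power2)
    also have "\<dots> = ?a^2 * (1 + (?b/?a + (\<beta>/?a) * x)^2)"
      using assms by (simp add: field_simps power2_eq_square)
    finally show ?thesis by (simp add: field_simps)
  qed
  ultimately show ?thesis by simp
qed

lemma continuous_on_Gamma_vertical:
  assumes "Re z > 0"
  shows "continuous_on A (\<lambda>\<tau>. Gamma (z + \<i> * of_real (\<beta> * \<tau>)))"
  by (rule continuous_on_compose2[OF continuous_on_Gamma[of "{z. 0 < Re z}"]])
     (use assms in \<open>auto elim!: nonpos_Ints_cases intro!: continuous_intros\<close>)

lemma integrable_Gamma_vertical:
  fixes z :: complex and \<beta> :: real
  assumes "Re z > 0" "\<beta> \<noteq> 0"
  shows "integrable lborel (\<lambda>\<tau>. Gamma (z + \<i> * of_real (\<beta> * \<tau>)))"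
proof (rule Bochner_Integration.integrable_bound)
  show "integrable lborel (\<lambda>\<tau>. Gamma (Re z + 2) * (1 / norm (z + \<i> * of_real (\<beta> * \<tau>)) ^ 2))"
    by (intro integrable_mult_right integrable_inverse_norm_square_vertical assms)
  show "(\<lambda>\<tau>. Gamma (z + \<i> * of_real (\<beta> * \<tau>))) \<in> borel_measurable lborel"
    using borel_measurable_continuous_onI[OF continuous_on_Gamma_vertical[OF assms(1)]] by simp
  show "AE \<tau> in lborel. norm (Gamma (z + \<i> * of_real (\<beta> * \<tau>)))
      \<le> norm (Gamma (Re z + 2) * (1 / norm (z + \<i> * of_real (\<beta> * \<tau>)) ^ 2))"
  proof (rule AE_I2)
    fix \<tau>
    have "Gamma (Re z + 2) > 0" using assms by (simp add: Gamma_real_pos)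
    then show "norm (Gamma (z + \<i> * of_real (\<beta> * \<tau>)))
      \<le> norm (Gamma (Re z + 2) * (1 / norm (z + \<i> * of_real (\<beta> * \<tau>)) ^ 2))"
      using norm_Gamma_le_power[of "z + \<i> * of_real (\<beta> * \<tau>)" 2] assms
      by (simp add: abs_mult)
  qed
qed

section \<open>Fourier inversion for an integrable characteristic function\<close>

lemma (in real_distribution) Levy_Inversion_integrable:
  assumes "a \<le> b" "measure M {a} = 0" "measure M {b} = 0"
    and int: "integrable lborel (char M)"
  shows "(CLINT t|lborel. (iexp (-(t * a)) - iexp (-(t * b))) / (\<i> * t) * char M t)
    = 2 * pi * measure M {a<..b}"
proof -
  define f where "f t = (iexp (-(t * a)) - iexp (-(t * b))) / (\<i> * t) * char M t" for t :: real
  have [measurable]: "f \<in> borel_measurable borel"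
    unfolding f_def by measurable
  have "norm (f t) \<le> (b - a) * norm (char M t)" for t
  proof (cases "t = 0")
    case False
    show ?thesis
      unfolding f_def norm_mult
      using Levy_Inversion_aux2[of "-b" "-a" t] assms False
      by (intro mult_right_mono) auto
  qed (use assms in \<open>simp add: f_def\<close>)
  then have f: "integrable lborel f"
    using assms by (intro Bochner_Integration.integrable_bound[of _ "\<lambda>t. (b - a) * norm (char M t)" f]) auto
  \<comment> \<open>\<open>Levy_Inversion\<close> yields a limit over symmetric intervals;
    integrability of \<open>f\<close> turns it into a Lebesgue integral by dominated
    convergence.\<close>
  have "(\<lambda>T::nat. CLBINT t=-real T..real T. f t) \<longlonglongrightarrow> (CLINT t|lborel. f t)"
  proof -
    have "(CLBINT t=-real T..real T. f t) = (CLINT t|lborel. indicator {-real T<..<real T} t *\<^sub>R f t)" for T :: nat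
      by (subst interval_integral_Ioo) (auto simp: set_lebesgue_integral_def)
    moreover have "(\<lambda>T. CLINT t|lborel. indicator {-real T<..<real T} t *\<^sub>R f t) \<longlonglongrightarrow> (CLINT t|lborel. f t)"
    proof (rule integral_dominated_convergence[where w = "\<lambda>t. norm (f t)"])
      show "AE t in lborel. (\<lambda>T. indicator {-real T<..<real T} t *\<^sub>R f t) \<longlonglongrightarrow> f t"
      proof (rule AE_I2)
        fix t :: real
        obtain N where N: "\<bar>t\<bar> < real N" using reals_Archimedean2 by blast
        have "\<forall>\<^sub>F T in sequentially. indicator {-real T<..<real T} t *\<^sub>R f t = f t"
          using eventually_ge_at_top[of N] by eventually_elim (use N in \<open>auto simp: indicator_def\<close>)
        then show "(\<lambda>T. indicator {-real T<..<real T} t *\<^sub>R f t) \<longlonglongrightarrow> f t"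
          by (rule tendsto_eventually)
      qed
    qed (use f in \<open>auto simp: indicator_def\<close>)
    ultimately show ?thesis by simp
  qed
  then have "(\<lambda>T::nat. 1 / (2 * pi) * (CLBINT t=-real T..real T. f t)) \<longlonglongrightarrow> 1 / (2 * pi) * (CLINT t|lborel. f t)"
    by (intro tendsto_intros)
  moreover have "(\<lambda>T::nat. 1 / (2 * pi) * (CLBINT t=-real T..real T. f t)) \<longlonglongrightarrow> measure M {a<..b}"
    using Levy_Inversion[OF assms(1-3)] unfolding f_def by simp
  ultimately have "1 / (2 * pi) * (CLINT t|lborel. f t) = measure M {a<..b}"
    by (rule LIMSEQ_unique)
  then show ?thesis unfolding f_def[symmetric] by (simp add: field_simps)
qed

text \<open>Levy's formula for \<open>{b<..b + h}\<close> is divided by h and h tends to 0 from the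
  right. The quotient kernel has modulus at most 1, so \<open>norm (char M t)\<close> dominates.
  Since no point has mass, the formula is available at every endpoint.\<close>

lemma (in real_distribution) Fourier_inversion:
  assumes int: "integrable lborel (char M)"
    and null: "\<And>x. measure M {x} = 0"
    and dens: "((\<lambda>h. measure M {b<..b + h} / h) \<longlongrightarrow> D) (at_right 0)"
  shows "(CLINT t|lborel. iexp (-(t * b)) * char M t) = 2 * pi * D"
proof -
  define h where "h n = inverse (real (Suc n))" for n
  have h: "h n > 0" for n by (simp add: h_def)
  have h0: "h \<longlonglongrightarrow> 0" unfolding h_def by (rule LIMSEQ_inverse_real_of_nat)
  define f where "f n t = (iexp (-(t * b)) - iexp (-(t * (b + h n)))) / (\<i> * t) / h n * char M t" for n and t :: real
  have lim1: "(\<lambda>n. CLINT t|lborel. f n t) \<longlonglongrightarrow> (CLINT t|lborel. iexp (-(t * b)) * char M t)"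
  proof (rule integral_dominated_convergence[where w = "\<lambda>t. norm (char M t)"])
    show "f n \<in> borel_measurable lborel" for n unfolding f_def by measurable
    show "integrable lborel (\<lambda>t. norm (char M t))" using int by simp
    show "AE t in lborel. norm (f n t) \<le> norm (char M t)" for n
    proof (rule AE_I2)
      fix t :: real
      have "norm ((iexp (-(t * b)) - iexp (-(t * (b + h n)))) / (\<i> * t)) \<le> h n"
        using Levy_Inversion_aux2[of "-(b + h n)" "-b" t] h[of n]
        by (cases "t = 0") (auto simp only: mult_minus_right, auto)
      then have "norm ((iexp (-(t * b)) - iexp (-(t * (b + h n)))) / (\<i> * t) / h n) \<le> 1"
        using h[of n] by (subst norm_divide) (simp add: field_simps)
      then show "norm (f n t) \<le> norm (char M t)"
        unfolding f_def norm_mult by (rule mult_left_le_one_le[rotated 2]) auto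
    qed
    show "AE t in lborel. (\<lambda>n. f n t) \<longlonglongrightarrow> iexp (-(t * b)) * char M t"
      \<comment> \<open>At t = 0 division by zero gives \<open>f n 0 = 0\<close>, whereas the
        claimed limit is \<open>char M 0 = 1\<close>; this point is dropped as a null set.\<close>
      using AE_lborel_singleton[of 0]
    proof eventually_elim
      fix t :: real assume t: "t \<noteq> 0"
      \<comment> \<open>\<open>F\<close> is an antiderivative of exp (-i t z), so the kernel in
        \<open>f n\<close> is its difference quotient at b with step \<open>h n\<close>.\<close>
      define F where "F z = - exp (- (\<i> * t * z)) / (\<i> * t)" for z
      have "(F has_field_derivative iexp (-(t * b))) (at (of_real b))"
        unfolding F_def using t by (auto intro!: derivative_eq_intros simp: mult_ac)
      then have "((\<lambda>y. (F y - F b) / (y - b)) \<longlongrightarrow> iexp (-(t * b))) (at (of_real b))"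
        by (simp add: has_field_derivative_iff)
      moreover have "filterlim (\<lambda>n. complex_of_real (b + h n)) (at (of_real b)) sequentially"
      proof (rule filterlim_atI)
        have "(\<lambda>n. complex_of_real (b + h n)) \<longlonglongrightarrow> of_real (b + 0)"
          by (intro tendsto_intros h0)
        then show "(\<lambda>n. complex_of_real (b + h n)) \<longlonglongrightarrow> of_real b" by simp
        show "\<forall>\<^sub>F n in sequentially. complex_of_real (b + h n) \<noteq> of_real b"
          using h by (auto intro!: always_eventually simp: less_imp_neq[symmetric])
      qed
      ultimately have "(\<lambda>n. (F (of_real (b + h n)) - F (of_real b)) / (complex_of_real (b + h n) - complex_of_real b)) \<longlonglongrightarrow> iexp (-(t * b))"
        by (rule filterlim_compose)
      moreover have "(F (of_real (b + h n)) - F (of_real b)) / (complex_of_real (b + h n) - complex_of_real b)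
          = (iexp (-(t * b)) - iexp (-(t * (b + h n)))) / (\<i> * t) / h n" for n
        unfolding F_def using t h[of n] by (simp add: field_simps)
      ultimately have "(\<lambda>n. (iexp (-(t * b)) - iexp (-(t * (b + h n)))) / (\<i> * t) / h n) \<longlonglongrightarrow> iexp (-(t * b))"
        by simp
      then show "(\<lambda>n. f n t) \<longlonglongrightarrow> iexp (-(t * b)) * char M t"
        unfolding f_def by (intro tendsto_mult tendsto_const)
    qed
  qed simp
  have eq: "(CLINT t|lborel. f n t) = of_real (2 * pi * (measure M {b<..b + h n} / h n))" for n
  proof -
    have "(CLINT t|lborel. f n t)
        = (CLINT t|lborel. (iexp (-(t * b)) - iexp (-(t * (b + h n)))) / (\<i> * t) * char M t) / h n"
      unfolding f_def by (subst integral_divide_zero[symmetric]) (simp add: field_simps)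
    also have "\<dots> = of_real (2 * pi * (measure M {b<..b + h n} / h n))"
      using h[of n] by (subst Levy_Inversion_integrable) (auto simp: int null)
    finally show ?thesis .
  qed
  have lim2: "(\<lambda>n. complex_of_real (2 * pi * (measure M {b<..b + h n} / h n))) \<longlonglongrightarrow> of_real (2 * pi * D)"
  proof (intro tendsto_intros)
    have "filterlim h (at_right 0) sequentially"
      using h0 h by (intro filterlim_atI tendsto_imp_filterlim_at_right) auto
    with dens show "(\<lambda>n. measure M {b<..b + h n} / h n) \<longlonglongrightarrow> D"
      by (rule filterlim_compose)
  qed
  show ?thesis
    by (rule LIMSEQ_unique[OF lim1[unfolded eq] lim2])
qed

text \<open>
  Fourier inversion for the logarithm of a Gamma(\<open>\<alpha>\<close>)-distributed variable, whose characteristic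
  function is \<open>\<Gamma>(\<alpha> + \<i>t) / \<Gamma>(\<alpha>)\<close>.
\<close>
lemma Cahen_Mellin_real:
  fixes \<alpha> b :: real
  assumes "\<alpha> > 0"
  shows "(CLINT t|lborel. iexp (-(t * b)) * Gamma (\<alpha> + \<i> * t)) = 2 * pi * exp (\<alpha> * b - exp b)"
proof -
  define d where "d y = (if 0 < y then y powr (\<alpha> - 1) / exp y / Gamma \<alpha> else 0)" for y :: real
  have G: "Gamma \<alpha> > 0" using assms by (rule Gamma_real_pos)
  have [measurable]: "d \<in> borel_measurable borel" unfolding d_def by measurable
  have d0: "d y \<ge> 0" for y using G by (simp add: d_def)
  have "((\<lambda>y. y powr (\<alpha> - 1) / exp y / Gamma \<alpha>) has_integral Gamma \<alpha> / Gamma \<alpha>) {0..}"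
    using Gamma_integral_real[OF assms] by (rule has_integral_divide)
  then have "((\<lambda>y. if y \<in> {0..} then y powr (\<alpha> - 1) / exp y / Gamma \<alpha> else 0) has_integral 1) UNIV"
    using G by (subst has_integral_restrict_UNIV) simp
  moreover have "(\<lambda>y. if y \<in> {0..} then y powr (\<alpha> - 1) / exp y / Gamma \<alpha> else 0) = d"
    by (auto simp: d_def)
  ultimately have dI: "(d has_integral 1) UNIV" by simp
  have nn: "(\<integral>\<^sup>+y. d y \<partial>lborel) = 1"
    using nn_integral_has_integral_lborel[OF _ d0 dI] by simp
  then have di: "integrable lborel d"
    using d0 by (intro integrableI_nonneg) auto
  define N where "N = density lborel d"
  interpret N: prob_space N
    by (rule prob_spaceI) (simp add: N_def emeasure_density nn)
  have lnN: "ln \<in> borel_measurable N" unfolding N_def by simp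
  define M where "M = distr N borel ln"
  interpret M: real_distribution M
    unfolding M_def using lnN by (rule N.real_distribution_distr)
  have LINT_M: "(LINT x|M. f x) = (LINT y|lborel. d y *\<^sub>R f (ln y))"
    if [measurable]: "f \<in> borel_measurable borel" for f :: "real \<Rightarrow> 'c::{banach, second_countable_topology}"
    unfolding M_def by (subst integral_distr[OF lnN]) (auto simp: N_def integral_density d0)
  have char: "char M t = Gamma (\<alpha> + \<i> * t) / Gamma \<alpha>" for t
  proof -
    have "char M t = (CLINT y|lborel. d y *\<^sub>R iexp (t * ln y))"
      unfolding char_def by (rule LINT_M) measurable
    moreover have "((\<lambda>y. d y *\<^sub>R iexp (t * ln y)) has_integral (CLINT y|lborel. d y *\<^sub>R iexp (t * ln y))) UNIV"
      by (rule has_integral_integral_lborel, rule Bochner_Integration.integrable_bound[OF di])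
         (auto simp: norm_exp_i_times simp del: of_real_mult)
    moreover have "((\<lambda>y. d y *\<^sub>R iexp (t * ln y)) has_integral Gamma (\<alpha> + \<i> * t) / Gamma \<alpha>) UNIV"
    proof -
      have "((\<lambda>y. of_real y powr (\<alpha> + \<i> * t - 1) / of_real (exp y) / Gamma \<alpha>) has_integral Gamma (\<alpha> + \<i> * t) / of_real (Gamma \<alpha>)) {0<..}"
        using assms by (intro has_integral_divide Gamma_integral_complex') simp
      then have "((\<lambda>y. if y \<in> {0<..} then of_real y powr (\<alpha> + \<i> * t - 1) / of_real (exp y) / Gamma \<alpha> else 0) has_integral Gamma (\<alpha> + \<i> * t) / of_real (Gamma \<alpha>)) UNIV"
        by (subst has_integral_restrict_UNIV)
      moreover have "(if y \<in> {0<..} then of_real y powr (\<alpha> + \<i> * t - 1) / of_real (exp y) / Gamma \<alpha> else 0) = d y *\<^sub>R iexp (t * ln y)" for y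
      proof (cases "0 < y")
        case True
        then have "of_real y powr (\<alpha> + \<i> * t - 1) = of_real (y powr (\<alpha> - 1)) * iexp (t * ln y)"
          by (simp add: powr_def Ln_of_real exp_of_real[symmetric] exp_add[symmetric] algebra_simps)
        then show ?thesis using True by (simp add: d_def scaleR_conv_of_real)
      qed (simp add: d_def)
      ultimately show ?thesis by (simp add: Gamma_complex_of_real)
    qed
    ultimately show ?thesis using has_integral_unique by metis
  qed
  have prob: "measure M A = (LINT y|lborel. d y * indicator A (ln y))" if "A \<in> sets borel" for A
  proof -
    have "measure M A = (LINT x|M. indicator A x)"
      using that by simp
    then show ?thesis using that by (subst (asm) LINT_M) auto
  qed
  have "(CLINT t|lborel. iexp (-(t * b)) * char M t) = 2 * pi * (exp b * d (exp b))"
  proof (rule M.Fourier_inversion)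
    have "integrable lborel (\<lambda>t. Gamma (complex_of_real \<alpha> + \<i> * of_real (1 * t)) / Gamma \<alpha>)"
      using assms by (intro integrable_divide integrable_Gamma_vertical) auto
    then show "integrable lborel (char M)"
      by (simp add: char[abs_def] Gamma_complex_of_real)
    show "measure M {x} = 0" for x
    proof -
      have "AE y in lborel. d y * indicator {x} (ln y) = 0"
        using AE_lborel_singleton[of "exp x"]
        by eventually_elim (auto simp: d_def indicator_def)
      then show ?thesis
        by (simp add: prob integral_eq_zero_AE)
    qed
    \<comment> \<open>With y = exp x the mass of \<open>{b<..x}\<close> becomes
      \<open>I (exp x)\<close>; the chain rule then produces the factor \<open>exp b\<close> in the
      density of the logarithm.\<close>
    define I where "I u = integral {exp b..u} d" for u
    have cont: "continuous_on {exp b..u} d" for u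
    proof -
      have pos: "0 < y" if "exp b \<le> y" for y using that exp_gt_zero[of b] by linarith
      have "continuous_on {exp b..u} (\<lambda>y. y powr (\<alpha> - 1) / exp y / Gamma \<alpha>)"
        using G pos by (auto intro!: continuous_intros)
      then show ?thesis
        by (rule continuous_on_cong[THEN iffD1, rotated 2]) (auto simp: d_def dest: pos)
    qed
    have mI: "measure M {b<..b + h} = I (exp (b + h))" for h
    proof -
      have "measure M {b<..b + h} = (LINT y|lborel. indicator {exp b..exp (b + h)} y *\<^sub>R d y)"
        unfolding prob[of "{b<..b + h}", simplified]
      proof (rule integral_cong_AE)
        show "AE y in lborel. d y * indicator {b<..b + h} (ln y) = indicator {exp b..exp (b + h)} y *\<^sub>R d y"
          \<comment> \<open>Dropping the point \<open>exp b\<close> reconciles the half-open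
            interval with the closed one. For y \<le> 0 both sides vanish with \<open>d\<close>,
            whatever value \<open>ln\<close> has there.\<close>
          using AE_lborel_singleton[of "exp b"]
        proof eventually_elim
          fix y assume y: "y \<noteq> exp b"
          show "d y * indicator {b<..b + h} (ln y) = indicator {exp b..exp (b + h)} y *\<^sub>R d y"
          proof (cases "0 < y")
            case True
            then obtain x where "y = exp x" by (metis exp_ln)
            then show ?thesis using y by (auto simp: indicator_def)
          qed (simp add: d_def)
        qed
      qed measurable
      also have "\<dots> = I (exp (b + h))"
        unfolding I_def set_lebesgue_integral_def[symmetric]
        by (intro set_borel_integral_eq_integral borel_integrable_atLeastAtMost' cont)
      finally show ?thesis .
    qed
    have I0: "I (exp b) = 0" by (simp add: I_def)
    have "(I has_real_derivative d (exp b)) (at (exp b) within {exp b..exp (b + 1)})"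
      unfolding I_def by (rule integral_has_real_derivative) (auto intro: cont)
    moreover have "exp ` {b..b + 1} \<subseteq> {exp b..exp (b + 1)}" by auto
    ultimately have "(I has_real_derivative d (exp b)) (at (exp b) within exp ` {b..b + 1})"
      by (rule DERIV_subset)
    moreover have "(exp has_real_derivative exp b) (at b within {b..b + 1})"
      by (auto intro!: derivative_eq_intros)
    ultimately have "((\<lambda>x. I (exp x)) has_real_derivative d (exp b) * exp b) (at b within {b..b + 1})"
      using DERIV_image_chain[of I _ exp] by (simp add: o_def)
    then have "((\<lambda>x. I (exp x) / (x - b)) \<longlongrightarrow> d (exp b) * exp b) (at b within {b..b + 1})"
      by (simp add: has_field_derivative_iff I0)
    then have "((\<lambda>x. I (exp x) / (x - b)) \<longlongrightarrow> d (exp b) * exp b) (at_right b)"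
      by (simp add: at_within_Icc_at_right)
    then show "((\<lambda>h. measure M {b<..b + h} / h) \<longlongrightarrow> exp b * d (exp b)) (at_right 0)"
      unfolding mI by (subst (asm) filterlim_at_right_to_0) (simp add: add.commute mult.commute)
  qed
  moreover have "exp b * d (exp b) = exp (\<alpha> * b - exp b) / Gamma \<alpha>"
    by (simp add: d_def powr_def exp_diff[symmetric] exp_add[symmetric] algebra_simps)
  ultimately have "(CLINT t|lborel. iexp (-(t * b)) * Gamma (\<alpha> + \<i> * t)) / Gamma \<alpha> = 2 * pi * (exp (\<alpha> * b - exp b) / Gamma \<alpha>)"
    by (simp add: char[abs_def])
  then show ?thesis using G by (simp add: Gamma_complex_of_real field_simps)
qed

text \<open>The line is traversed at speed 1/2 because \<Gamma> will occur at (s + 1)/2 with s = c +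
  i\<tau>. The substitution t = Im z + \<tau>/2 doubles the constant 2\<pi>, and the modulus of the
  exponential cancels the factor \<open>exp (Re z * b)\<close> of the real case.\<close>

lemma Cahen_Mellin:
  fixes z :: complex and b :: real
  assumes "Re z > 0"
  shows "(CLINT \<tau>|lborel. Gamma (z + \<i> * of_real (\<tau> / 2)) * exp (- ((z + \<i> * of_real (\<tau> / 2)) * of_real b)))
    = 4 * pi * exp (- exp b)"
proof -
  define f where "f t = iexp (-(t * b)) * Gamma (Re z + \<i> * of_real t)" for t
  have "Gamma (z + \<i> * of_real (\<tau> / 2)) * exp (- ((z + \<i> * of_real (\<tau> / 2)) * of_real b))
      = exp (- (Re z * b)) * f (Im z + 1/2 * \<tau>)" for \<tau>
  proof -
    have "complex_of_real (Re z) + \<i> * of_real (Im z + 1/2 * \<tau>) = z + \<i> * of_real (\<tau> / 2)"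
      by (simp add: complex_eq_iff)
    moreover have "exp (- ((z + \<i> * of_real (\<tau> / 2)) * of_real b))
        = of_real (exp (- (Re z * b))) * iexp (-((Im z + 1/2 * \<tau>) * b))"
      unfolding exp_of_real[symmetric] exp_add[symmetric]
      by (rule arg_cong[of _ _ exp]) (simp add: complex_eq_iff)
    ultimately show ?thesis by (simp add: f_def)
  qed
  then have "(CLINT \<tau>|lborel. Gamma (z + \<i> * of_real (\<tau> / 2)) * exp (- ((z + \<i> * of_real (\<tau> / 2)) * of_real b)))
      = of_real (exp (- (Re z * b))) * (CLINT \<tau>|lborel. f (Im z + 1/2 * \<tau>))"
    by (simp only: integral_mult_right_zero)
  also have "(CLINT \<tau>|lborel. f (Im z + 1/2 * \<tau>)) = 2 * (CLINT t|lborel. f t)"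
    by (subst lborel_integral_real_affine[of "1/2" f "Im z"]) (auto simp: scaleR_conv_of_real)
  also have "(CLINT t|lborel. f t) = 2 * pi * exp (Re z * b - exp b)"
    unfolding f_def using assms by (rule Cahen_Mellin_real)
  also have "of_real (exp (- (Re z * b))) * (2 * complex_of_real (2 * pi * exp (Re z * b - exp b)))
      = complex_of_real (4 * pi * (exp (- (Re z * b)) * exp (Re z * b - exp b)))"
    by (simp only: of_real_mult of_real_numeral) (simp add: mult_ac)
  also have "exp (- (Re z * b)) * exp (Re z * b - exp b) = exp (- exp b)"
    by (simp add: exp_add[symmetric])
  finally show ?thesis .
qed

subsection \<open>Parseval's formula for Mellin transforms\<close>

lemma real_cosh_gt_0: "0 < 2 * cosh (x::real)" by (simp add: cosh_real_pos)

lemma filterlim_cosh_at_infinity: "filterlim (\<lambda>x::real. 2 * cosh x) at_top at_infinity"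
proof (rule filterlim_at_top_mono)
  show "filterlim (\<lambda>x::real. \<bar>x\<bar>) at_top at_infinity"
    using filterlim_norm_at_top[where 'a=real] by (simp add: real_norm_def[abs_def])
  have "\<bar>x\<bar> \<le> 2 * cosh x" for x :: real
  proof -
    have "2 * cosh x = exp x + exp (- x)" by (simp add: cosh_def)
    then show ?thesis
      using exp_ge_add_one_self[of x] exp_ge_add_one_self[of "-x"] exp_gt_zero[of x] exp_gt_zero[of "-x"]
      by linarith
  qed
  then show "\<forall>\<^sub>F x::real in at_infinity. \<bar>x\<bar> \<le> 2 * cosh x" by simp
qed

text \<open>With v = exp x this is integrability of 1/(2 cosh (\<delta> x)). In the variable v an
  antiderivative is arctan (v powr \<delta>)/\<delta>, which has finite limits at 0 and at
  infinity.\<close>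

lemma set_integrable_inverse_cosh_ln:
  fixes \<delta> :: real
  assumes "\<delta> > 0"
  shows "set_integrable lborel {0<..} (\<lambda>v::real. 1 / (v * (2 * cosh (\<delta> * ln v))))"
proof -
  have ln_bot: "filterlim (\<lambda>v. \<delta> * ln v) at_bot (at_right (0::real))"
    using assms ln_at_0 by (simp add: filterlim_tendsto_pos_mult_at_bot_iff[OF tendsto_const])
  have ln_top: "filterlim (\<lambda>v::real. \<delta> * ln v) at_top at_top"
    using assms ln_at_top by (simp add: filterlim_tendsto_pos_mult_at_top_iff[OF tendsto_const])
  have "set_integrable lborel (einterval 0 \<infinity>) (\<lambda>v. 1 / (v * (2 * cosh (\<delta> * ln v))))"
  proof (rule interval_integral_FTC_nonneg(1)[where F = "\<lambda>v. arctan (exp (\<delta> * ln v)) / \<delta>"])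
    show "((\<lambda>v. arctan (exp (\<delta> * ln v)) / \<delta>) has_real_derivative 1 / (x * (2 * cosh (\<delta> * ln x)))) (at x)"
      if "0 < ereal x" for x
    proof -
      have x: "x > 0" using that by simp
      define e where "e = exp (\<delta> * ln x)"
      have e: "e > 0" by (simp add: e_def)
      have "2 * cosh (\<delta> * ln x) = (1 + e\<^sup>2) / e"
        using e by (simp add: cosh_def e_def exp_minus field_simps power2_eq_square)
      then have c: "1 / (x * (2 * cosh (\<delta> * ln x))) = inverse (1 + e\<^sup>2) * (e * (\<delta> * (1 / x))) / \<delta>"
        using x e assms by (simp add: divide_inverse mult_ac)
      show ?thesis
        unfolding c e_def using x assms by (auto intro!: derivative_eq_intros)
    qed
    show "isCont (\<lambda>v. 1 / (v * (2 * cosh (\<delta> * ln v)))) x" if "0 < ereal x" for x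
      using that real_cosh_gt_0[of "\<delta> * ln x"] by (auto intro!: continuous_intros)
    show "(((\<lambda>v. arctan (exp (\<delta> * ln v)) / \<delta>) \<circ> real_of_ereal) \<longlongrightarrow> arctan 0 / \<delta>) (at_right 0)"
      unfolding zero_ereal_def ereal_tendsto_simps
      using assms by (intro tendsto_intros filterlim_compose[OF exp_at_bot ln_bot]) auto
    show "(((\<lambda>v. arctan (exp (\<delta> * ln v)) / \<delta>) \<circ> real_of_ereal) \<longlongrightarrow> (pi/2) / \<delta>) (at_left \<infinity>)"
      unfolding ereal_tendsto_simps
      using assms by (intro tendsto_intros filterlim_compose[OF tendsto_arctan_at_top]
          filterlim_compose[OF exp_at_top ln_top]) auto
    show "AE x in lborel. 0 < ereal x \<longrightarrow> ereal x < \<infinity> \<longrightarrow> 0 \<le> 1 / (x * (2 * cosh (\<delta> * ln x)))"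
      using cosh_real_nonneg by (intro AE_I2) auto
  qed simp
  then show ?thesis by (simp add: zero_ereal_def)
qed

text \<open>
  The kernel is \<open>v\<^sup>-\<^sup>i\<^sup>\<tau> / (v\<^sup>\<delta> + v\<^sup>-\<^sup>\<delta>)\<close>. The damping factor
  vanishes at both ends of the half-line and is compensated by passing from \<open>h\<close> to
  \<open>(v\<^sup>\<delta> + v\<^sup>-\<^sup>\<delta>) h\<close>; it makes the derivative of the kernel Lebesgue integrable.
\<close>
definition mellin_kernel :: "real \<Rightarrow> real \<Rightarrow> real \<Rightarrow> complex" where
  "mellin_kernel \<delta> \<tau> v = exp (- (\<i> * \<tau> * of_real (ln v))) / (2 * cosh (\<delta> * ln v))"

definition mellin_kernel_deriv :: "real \<Rightarrow> real \<Rightarrow> real \<Rightarrow> complex" where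
  "mellin_kernel_deriv \<delta> \<tau> v =
     exp (- (\<i> * \<tau> * of_real (ln v))) * (- \<i> * \<tau> - \<delta> * tanh (\<delta> * ln v)) / (v * (2 * cosh (\<delta> * ln v)))"

text \<open>The oscillating exponential has modulus 1 and tanh is bounded by 1, so \<tau> enters
  only linearly; this is the origin of the weight that \<open>mellin_parseval\<close> puts on
  \<open>F\<close>.\<close>

lemma norm_mellin_kernel_deriv:
  assumes "\<delta> > 0" "v > 0"
  shows "norm (mellin_kernel_deriv \<delta> \<tau> v) \<le> (\<bar>\<tau>\<bar> + \<delta>) * (1 / (v * (2 * cosh (\<delta> * ln v))))"
proof -
  have "norm (- \<i> * \<tau> - complex_of_real (\<delta> * tanh (\<delta> * ln v))) \<le> \<bar>\<tau>\<bar> + \<bar>\<delta> * tanh (\<delta> * ln v)\<bar>"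
    by (rule order_trans[OF norm_triangle_ineq4]) (simp add: norm_mult)
  also have "\<bar>\<delta> * tanh (\<delta> * ln v)\<bar> \<le> \<delta>"
    using tanh_real_bounds[of "\<delta> * ln v"] assms by (simp add: abs_mult abs_le_iff)
  finally have *: "norm (- \<i> * \<tau> - complex_of_real (\<delta> * tanh (\<delta> * ln v))) \<le> \<bar>\<tau>\<bar> + \<delta>" by simp
  have "norm (exp (- (\<i> * \<tau> * of_real (ln v)))) = 1" by (simp add: norm_exp_eq_Re)
  moreover have "norm (complex_of_real (v * (2 * cosh (\<delta> * ln v)))) = v * (2 * cosh (\<delta> * ln v))"
    using assms real_cosh_gt_0[of "\<delta> * ln v"] by (subst norm_of_real) (simp add: abs_mult)
  ultimately show ?thesis
    unfolding mellin_kernel_deriv_def norm_divide norm_mult[of "exp _"] using * assms real_cosh_gt_0[of "\<delta> * ln v"]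
    by (simp add: divide_right_mono)
qed

lemma measurable_mellin_kernel_deriv [measurable]:
  "(\<lambda>(\<tau>, v). mellin_kernel_deriv \<delta> \<tau> v) \<in> borel_measurable (lborel \<Otimes>\<^sub>M lborel)"
  unfolding mellin_kernel_deriv_def cosh_def tanh_def sinh_def by measurable

lemma set_integrable_mellin_kernel_deriv:
  assumes "\<delta> > 0"
  shows "set_integrable lborel {0<..} (mellin_kernel_deriv \<delta> \<tau>)"
  unfolding set_integrable_def
proof (rule Bochner_Integration.integrable_bound)
  show "integrable lborel (\<lambda>v. (\<bar>\<tau>\<bar> + \<delta>) *\<^sub>R (indicator {0<..} v *\<^sub>R (1 / (v * (2 * cosh (\<delta> * ln v))))))"
    using set_integrable_inverse_cosh_ln[OF assms] unfolding set_integrable_def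
    by (rule integrable_scaleR_right)
  show "(\<lambda>v. indicator {0<..} v *\<^sub>R mellin_kernel_deriv \<delta> \<tau> v) \<in> borel_measurable lborel"
    unfolding mellin_kernel_deriv_def cosh_def tanh_def sinh_def by measurable
  show "AE v in lborel. norm (indicator {0<..} v *\<^sub>R mellin_kernel_deriv \<delta> \<tau> v)
      \<le> norm ((\<bar>\<tau>\<bar> + \<delta>) *\<^sub>R (indicator {0<..} v *\<^sub>R (1 / (v * (2 * cosh (\<delta> * ln v))))))"
    using norm_mellin_kernel_deriv[OF assms] assms real_cosh_gt_0
    by (intro AE_I2) (auto simp: indicator_def abs_mult)
qed

text \<open>The kernel tends to 0 at 0 because cosh (\<delta> ln v) blows up there, so the
  fundamental theorem leaves no boundary term. The nested indicators match the form in which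
  \<open>has_integral_Ioi_mult_parametric_integral\<close> expects \<open>E\<close> and
  \<open>k\<close>.\<close>

lemma mellin_kernel_eq_integral:
  assumes "\<delta> > 0" "x > 0"
  shows "mellin_kernel \<delta> \<tau> x =
    (LINT v|lborel. indicator {..x} v *\<^sub>R (indicator {0<..} v *\<^sub>R mellin_kernel_deriv \<delta> \<tau> v))"
proof -
  have ln_bot: "filterlim (\<lambda>v. \<delta> * ln v) at_bot (at_right (0::real))"
    using assms ln_at_0 by (simp add: filterlim_tendsto_pos_mult_at_bot_iff[OF tendsto_const])
  have deriv: "(mellin_kernel \<delta> \<tau> has_vector_derivative mellin_kernel_deriv \<delta> \<tau> y) (at y)" if "y > 0" for y
  proof -
    define A where "A = exp (- (\<i> * complex_of_real \<tau> * complex_of_real (ln y)))"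
    define c where "c = 2 * cosh (\<delta> * ln y)"
    have c: "c \<noteq> 0" using real_cosh_gt_0[of "\<delta> * ln y"] by (simp add: c_def)
    have 1: "((\<lambda>v. complex_of_real (ln v)) has_vector_derivative of_real (1 / y)) (at y)"
      using that by (intro has_vector_derivative_of_real) (auto intro!: derivative_eq_intros simp: has_real_derivative_iff_has_vector_derivative[symmetric])
    have 2: "((\<lambda>z. exp (- (\<i> * complex_of_real \<tau> * z))) has_field_derivative - \<i> * \<tau> * A) (at (complex_of_real (ln y)))"
      unfolding A_def by (auto intro!: derivative_eq_intros)
    have "((\<lambda>v. exp (- (\<i> * complex_of_real \<tau> * complex_of_real (ln v)))) has_vector_derivative of_real (1 / y) * (- \<i> * \<tau> * A)) (at y)"
      using field_vector_diff_chain_at[OF 1 2] by (simp add: o_def)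
    moreover have "((\<lambda>v. 1 / (2 * cosh (\<delta> * ln v))) has_vector_derivative - (\<delta> * tanh (\<delta> * ln y)) / (y * c)) (at y)"
      unfolding has_real_derivative_iff_has_vector_derivative[symmetric] c_def tanh_def
      using that real_cosh_gt_0[of "\<delta> * ln y"]
      by (auto intro!: derivative_eq_intros simp: field_simps power2_eq_square)
    ultimately have "((\<lambda>v. (1 / (2 * cosh (\<delta> * ln v))) *\<^sub>R exp (- (\<i> * complex_of_real \<tau> * complex_of_real (ln v))))
      has_vector_derivative ((1 / c) *\<^sub>R (of_real (1 / y) * (- \<i> * \<tau> * A)) + (- (\<delta> * tanh (\<delta> * ln y)) / (y * c)) *\<^sub>R A)) (at y)"
      unfolding c_def A_def
      by (intro has_vector_derivative_scaleR) (simp add: has_real_derivative_iff_has_vector_derivative)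
    moreover have "(1 / c) *\<^sub>R (of_real (1 / y) * (- \<i> * \<tau> * A)) + (- (\<delta> * tanh (\<delta> * ln y)) / (y * c)) *\<^sub>R A
        = mellin_kernel_deriv \<delta> \<tau> y"
      unfolding mellin_kernel_deriv_def c_def[symmetric] A_def[symmetric] using that c
      by (simp add: scaleR_conv_of_real field_simps)
    ultimately show ?thesis
      by (simp add: mellin_kernel_def[abs_def] scaleR_conv_of_real)
  qed
  have int: "set_integrable lborel {0<..<x} (mellin_kernel_deriv \<delta> \<tau>)"
    using set_integrable_mellin_kernel_deriv[OF assms(1)] by (rule set_integrable_subset) auto
  have "(LBINT y=0..x. mellin_kernel_deriv \<delta> \<tau> y) = mellin_kernel \<delta> \<tau> x - 0"
  proof (rule interval_integral_FTC_integrable)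
    show "(mellin_kernel \<delta> \<tau> has_vector_derivative mellin_kernel_deriv \<delta> \<tau> y) (at y)" if "0 < ereal y" for y
      using that by (intro deriv) simp
    show "isCont (mellin_kernel_deriv \<delta> \<tau>) y" if "0 < ereal y" for y
      unfolding mellin_kernel_deriv_def[abs_def] using that real_cosh_gt_0[of "\<delta> * ln y"]
      by (auto intro!: continuous_intros)
    show "set_integrable lborel (einterval 0 (ereal x)) (mellin_kernel_deriv \<delta> \<tau>)"
      using int by (simp add: zero_ereal_def)
    have "((\<lambda>v. 1 / (2 * cosh (\<delta> * ln v))) \<longlongrightarrow> 0) (at_right 0)"
      by (rule tendsto_divide_0[OF tendsto_const])
         (intro filterlim_at_top_imp_at_infinity filterlim_compose[OF filterlim_cosh_at_infinity]
           filterlim_mono[OF ln_bot at_bot_le_at_infinity order_refl])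
    then have "(mellin_kernel \<delta> \<tau> \<longlongrightarrow> 0) (at_right 0)"
    proof (rule Lim_null_comparison[rotated])
      show "\<forall>\<^sub>F v in at_right 0. norm (mellin_kernel \<delta> \<tau> v) \<le> 1 / (2 * cosh (\<delta> * ln v))"
        by (intro always_eventually allI)
           (simp add: mellin_kernel_def norm_divide norm_mult norm_exp_eq_Re abs_of_pos cosh_real_pos)
    qed
    then show "((mellin_kernel \<delta> \<tau> \<circ> real_of_ereal) \<longlongrightarrow> 0) (at_right 0)"
      by (simp add: zero_ereal_def ereal_tendsto_simps)
    have "isCont (mellin_kernel \<delta> \<tau>) x"
      using deriv[OF assms(2)] by (rule has_vector_derivative_continuous)
    then have "(mellin_kernel \<delta> \<tau> \<longlongrightarrow> mellin_kernel \<delta> \<tau> x) (at_left x)"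
      by (simp add: isCont_def filterlim_at_split)
    then show "((mellin_kernel \<delta> \<tau> \<circ> real_of_ereal) \<longlongrightarrow> mellin_kernel \<delta> \<tau> x) (at_left (ereal x))"
      by (simp add: ereal_tendsto_simps)
  qed (use assms in auto)
  also have "(LBINT y=0..x. mellin_kernel_deriv \<delta> \<tau> y) = (LINT v|lborel. indicator {0<..<x} v *\<^sub>R mellin_kernel_deriv \<delta> \<tau> v)"
    using assms by (subst interval_integral_Ioo) (auto simp: set_lebesgue_integral_def zero_ereal_def)
  also have "\<dots> = (LINT v|lborel. indicator {..x} v *\<^sub>R (indicator {0<..} v *\<^sub>R mellin_kernel_deriv \<delta> \<tau> v))"
  proof (rule integral_cong_AE)
    show "AE v in lborel. indicator {0<..<x} v *\<^sub>R mellin_kernel_deriv \<delta> \<tau> v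
        = indicator {..x} v *\<^sub>R (indicator {0<..} v *\<^sub>R mellin_kernel_deriv \<delta> \<tau> v)"
      using AE_lborel_singleton[of x] by eventually_elim (auto simp: indicator_def)
  qed (use int set_integrable_mellin_kernel_deriv[OF assms(1), of \<tau>] in
        \<open>auto simp: set_integrable_def intro!: borel_measurable_scaleR borel_measurable_integrable borel_measurable_indicator\<close>)
  finally show ?thesis by simp
qed

text \<open>The product of \<open>w\<close> and the kernel is y powr (-i\<tau>) times h, so the
  parametric Fubini theorem applies to \<open>w\<close>. Up to the integral of \<open>Q\<close>, the
  weight \<bar>\<tau>\<bar> + \<delta> bounds the L1 norm of \<open>k \<tau>\<close>, which makes
  \<open>F \<tau> * k \<tau> v\<close> absolutely integrable on the plane.\<close>

lemma mellin_parseval: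
  fixes h F :: "real \<Rightarrow> complex" and \<delta> :: real
  assumes \<delta>: "\<delta> > 0"
    and h1: "(\<lambda>y. of_real (y powr \<delta>) * h y) integrable_on {0<..}"
    and h2: "(\<lambda>y. of_real (y powr (- \<delta>)) * h y) integrable_on {0<..}"
    and F: "F \<in> borel_measurable borel"
    and int: "integrable lborel (\<lambda>\<tau>. of_real (\<bar>\<tau>\<bar> + \<delta>) * F \<tau>)"
  shows "integrable lborel (\<lambda>\<tau>. F \<tau> * integral {0<..} (\<lambda>y. exp (- (\<i> * \<tau> * of_real (ln y))) * h y))"
    and "((\<lambda>y. h y * (LINT \<tau>|lborel. F \<tau> * exp (- (\<i> * \<tau> * of_real (ln y))))) has_integral
           (LINT \<tau>|lborel. F \<tau> * integral {0<..} (\<lambda>y. exp (- (\<i> * \<tau> * of_real (ln y))) * h y))) {0<..}"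
proof -
  define w where "w y = of_real (y powr \<delta>) * h y + of_real (y powr (- \<delta>)) * h y" for y
  define k where "k \<tau> v = indicator {0<..} v *\<^sub>R mellin_kernel_deriv \<delta> \<tau> v" for \<tau> v
  \<comment> \<open>The bound for \<open>k \<tau> v\<close> splits into \<bar>\<tau>\<bar> +
    \<delta> and this function of v, so the double integral is bounded by a product.\<close>
  define Q where "Q v = indicator {0<..} v *\<^sub>R (1 / (v * (2 * cosh (\<delta> * ln v))))" for v :: real
  have w: "w integrable_on {0<..}" unfolding w_def using h1 h2 by (rule integrable_add)
  have w_eq: "w y * mellin_kernel \<delta> \<tau> y = exp (- (\<i> * \<tau> * of_real (ln y))) * h y" if "y > 0" for y \<tau>
  proof -
    have "2 * cosh (\<delta> * ln y) = y powr \<delta> + y powr (- \<delta>)"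
      using that by (simp add: cosh_def powr_def)
    moreover have "y powr \<delta> + y powr (- \<delta>) \<noteq> 0"
      using that by (simp add: add_pos_pos less_imp_neq[symmetric])
    moreover from this have "complex_of_real (y powr \<delta>) + of_real (y powr (- \<delta>)) \<noteq> 0"
      by (metis of_real_add of_real_eq_0_iff)
    ultimately show ?thesis
      unfolding w_def mellin_kernel_def by (simp add: distrib_right[symmetric])
  qed
  have Q: "integrable lborel Q"
    using set_integrable_inverse_cosh_ln[OF \<delta>] unfolding Q_def set_integrable_def .
  have Q0: "Q v \<ge> 0" for v
    unfolding Q_def using cosh_real_nonneg by (simp add: indicator_def)
  have kQ: "norm (k \<tau> v) \<le> (\<bar>\<tau>\<bar> + \<delta>) * Q v" for \<tau> v
    unfolding k_def Q_def using norm_mellin_kernel_deriv[OF \<delta>, of v \<tau>] by (simp add: indicator_def)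
  have k: "integrable lborel (k \<tau>)" for \<tau>
    using set_integrable_mellin_kernel_deriv[OF \<delta>] unfolding k_def set_integrable_def .
  have [measurable]: "(\<lambda>(\<tau>, v). k \<tau> v) \<in> borel_measurable (lborel \<Otimes>\<^sub>M lborel)"
    unfolding k_def by measurable
  have Fk: "integrable (lborel \<Otimes>\<^sub>M lborel) (\<lambda>(\<tau>, v). F \<tau> * k \<tau> v)"
  proof (rule lborel_pair.Fubini_integrable)
    show meas: "(\<lambda>(\<tau>, v). F \<tau> * k \<tau> v) \<in> borel_measurable (lborel \<Otimes>\<^sub>M lborel)"
      using F by measurable
    show "AE \<tau> in lborel. integrable lborel (\<lambda>v. case (\<tau>, v) of (\<tau>, v) \<Rightarrow> F \<tau> * k \<tau> v)"
      using k by simp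
    show "integrable lborel (\<lambda>\<tau>. LINT v|lborel. norm (case (\<tau>, v) of (\<tau>, v) \<Rightarrow> F \<tau> * k \<tau> v))"
    proof (rule Bochner_Integration.integrable_bound)
      show "integrable lborel (\<lambda>\<tau>. norm (of_real (\<bar>\<tau>\<bar> + \<delta>) * F \<tau>) * (LINT v|lborel. Q v))"
        using int by (intro integrable_mult_left integrable_norm)
      show "(\<lambda>\<tau>. LINT v|lborel. norm (case (\<tau>, v) of (\<tau>, v) \<Rightarrow> F \<tau> * k \<tau> v)) \<in> borel_measurable lborel"
        using F by measurable
      have le: "(LINT v|lborel. norm (F \<tau> * k \<tau> v)) \<le> norm (of_real (\<bar>\<tau>\<bar> + \<delta>) * F \<tau>) * (LINT v|lborel. Q v)" for \<tau>
      proof -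
        have "(LINT v|lborel. norm (F \<tau> * k \<tau> v)) \<le> (LINT v|lborel. norm (F \<tau>) * (\<bar>\<tau>\<bar> + \<delta>) * Q v)"
        proof (rule Bochner_Integration.integral_mono)
          show "norm (F \<tau> * k \<tau> v) \<le> norm (F \<tau>) * (\<bar>\<tau>\<bar> + \<delta>) * Q v" for v
            using kQ[of \<tau> v] by (simp add: norm_mult mult.assoc mult_left_mono)
        qed (use k Q in auto)
        also have "\<dots> = norm (of_real (\<bar>\<tau>\<bar> + \<delta>) * F \<tau>) * (LINT v|lborel. Q v)"
          using \<delta> by (simp add: norm_mult flip: of_real_add)
        finally show ?thesis .
      qed
      have nonneg: "0 \<le> (LINT v|lborel. norm (F \<tau> * k \<tau> v))" for \<tau> by simp
      show "AE \<tau> in lborel. norm (LINT v|lborel. norm (case (\<tau>, v) of (\<tau>, v) \<Rightarrow> F \<tau> * k \<tau> v))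
          \<le> norm (norm (of_real (\<bar>\<tau>\<bar> + \<delta>) * F \<tau>) * (LINT v|lborel. Q v))"
        using le nonneg by (intro AE_I2) (simp only: prod.case real_norm_def abs_of_nonneg order_trans[OF _ abs_ge_self])
    qed
  qed
  have E: "mellin_kernel \<delta> \<tau> x = (LINT v|lborel. indicator {..x} v *\<^sub>R k \<tau> v)" if "0 < x" for \<tau> x
    unfolding k_def using mellin_kernel_eq_integral[OF \<delta> that] .
  note L = has_integral_Ioi_mult_parametric_integral[OF w Fk k E]
  have eq: "integral {0<..} (\<lambda>x. w x * mellin_kernel \<delta> \<tau> x) = integral {0<..} (\<lambda>y. exp (- (\<i> * \<tau> * of_real (ln y))) * h y)" for \<tau>
    by (rule integral_cong) (simp add: w_eq)
  show "integrable lborel (\<lambda>\<tau>. F \<tau> * integral {0<..} (\<lambda>y. exp (- (\<i> * \<tau> * of_real (ln y))) * h y))"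
    using L(2) unfolding eq .
  show "((\<lambda>y. h y * (LINT \<tau>|lborel. F \<tau> * exp (- (\<i> * \<tau> * of_real (ln y))))) has_integral
           (LINT \<tau>|lborel. F \<tau> * integral {0<..} (\<lambda>y. exp (- (\<i> * \<tau> * of_real (ln y))) * h y))) {0<..}"
  proof (rule has_integral_eq[OF _ L(3)[unfolded eq]])
    fix y :: real assume "y \<in> {0<..}"
    then have y: "y > 0" by simp
    have "w y * (LINT \<tau>|lborel. F \<tau> * mellin_kernel \<delta> \<tau> y) = (LINT \<tau>|lborel. F \<tau> * (w y * mellin_kernel \<delta> \<tau> y))"
      by (subst integral_mult_right_zero[symmetric]) (simp add: mult_ac)
    also have "\<dots> = h y * (LINT \<tau>|lborel. F \<tau> * exp (- (\<i> * \<tau> * of_real (ln y))))"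
      unfolding w_eq[OF y] by (subst integral_mult_right_zero[symmetric]) (simp add: mult_ac)
    finally show "w y * (LINT \<tau>|lborel. F \<tau> * mellin_kernel \<delta> \<tau> y)
        = h y * (LINT \<tau>|lborel. F \<tau> * exp (- (\<i> * \<tau> * of_real (ln y))))" .
  qed
qed

subsection \<open>The Gamma factor times the confluent hypergeometric function\<close>

lemma summable_Gamma_power:
  fixes a q :: real
  assumes "a > 0" "q \<ge> 0"
  shows "summable (\<lambda>n. Gamma (a + real n) * q ^ n / (fact n)\<^sup>2)"
proof -
  \<comment> \<open>As a + n \<le> (a + 1)(n + 1), consecutive terms have ratio at most (a + 1) q/(n
    + 1), which is at most 1/2 as soon as n \<ge> 2 (a + 1) q.\<close>
  obtain N where N: "2 * ((a + 1) * q) \<le> real N"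
    using real_arch_simple by blast
  show ?thesis
  proof (rule summable_ratio_test[of "1/2" N])
    fix n assume "n \<ge> N"
    define G where "G = Gamma (a + real n) * q ^ n / (fact n)\<^sup>2"
    have "Gamma (a + real n) > 0" using assms by (intro Gamma_real_pos) simp
    then have G: "G \<ge> 0" using assms by (simp add: G_def)
    have "a + real n \<notin> \<int>\<^sub>\<le>\<^sub>0" using assms by (auto elim!: nonpos_Ints_cases)
    then have "Gamma (a + real (Suc n)) = (a + real n) * Gamma (a + real n)"
      using Gamma_plus1[of "a + real n"] by (simp add: add_ac)
    then have eq: "Gamma (a + real (Suc n)) * q ^ Suc n / (fact (Suc n))\<^sup>2
        = ((a + real n) * q / (real n + 1)\<^sup>2) * G"
    proof -
      have fs: "fact (Suc n) = (real n + 1) * fact n" by (simp add: algebra_simps)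
      show ?thesis
        unfolding fs G_def power_mult_distrib using \<open>Gamma (a + real (Suc n)) = _\<close> by (simp add: mult_ac)
    qed
    have "(a + real n) * q \<le> (a + 1) * (real n + 1) * q"
      using assms by (intro mult_right_mono) (auto simp: algebra_simps)
    also have "\<dots> = ((a + 1) * q) * (real n + 1)" by simp
    also have "\<dots> \<le> ((real n + 1) / 2) * (real n + 1)"
      using N \<open>n \<ge> N\<close> by (intro mult_right_mono) auto
    finally have "(a + real n) * q / (real n + 1)\<^sup>2 \<le> 1/2"
      by (subst pos_divide_le_eq) (simp_all add: power2_eq_square)
    then have "((a + real n) * q / (real n + 1)\<^sup>2) * G \<le> 1/2 * G"
      using G by (rule mult_right_mono)
    moreover have "0 \<le> ((a + real n) * q / (real n + 1)\<^sup>2) * G" using G assms by simp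
    ultimately show "norm (Gamma (a + real (Suc n)) * q ^ Suc n / (fact (Suc n))\<^sup>2)
        \<le> 1/2 * norm (Gamma (a + real n) * q ^ n / (fact n)\<^sup>2)"
      unfolding eq G_def[symmetric] using G by simp
  qed simp
qed

text \<open>The decay is expressed through z instead of z + n: the factor
  \<open>1 / norm z ^ k\<close> is then common to all terms and can be taken out of the
  series.\<close>

lemma norm_Gamma_add_nat_le:
  assumes "Re z > 0"
  shows "norm (Gamma (z + of_nat n)) \<le> Gamma (Re z + real k + real n) / norm z ^ k"
proof -
  have "norm (Gamma (z + of_nat n)) \<le> Gamma (Re (z + of_nat n) + real k) / norm (z + of_nat n) ^ k"
    using assms by (intro norm_Gamma_le_power) simp
  also have "\<dots> \<le> Gamma (Re (z + of_nat n) + real k) / norm z ^ k"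
  proof (intro divide_left_mono power_mono)
    show "norm z \<le> norm (z + of_nat n)"
      using assms by (intro norm_le_norm_add_nat) simp
    have "Gamma (Re (z + of_nat n) + real k) > 0" using assms by (intro Gamma_real_pos) simp
    then show "0 \<le> Gamma (Re (z + of_nat n) + real k)" by simp
    have "z \<noteq> 0" "z + of_nat n \<noteq> 0" using assms by (auto simp: complex_eq_iff)
    then show "0 < norm (z + of_nat n) ^ k * norm z ^ k" by simp
  qed simp
  finally show ?thesis by (simp add: add_ac)
qed

lemma norm_Gamma_term_le:
  assumes "Re z > 0" "q \<ge> 0"
  shows "norm (Gamma (z + of_nat n) * of_real q ^ n / (fact n)\<^sup>2)
    \<le> Gamma (Re z + real k + real n) * q ^ n / (fact n)\<^sup>2 * (1 / norm z ^ k)"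
proof -
  have "norm (Gamma (z + of_nat n) * of_real q ^ n / (fact n)\<^sup>2) = norm (Gamma (z + of_nat n)) * (q ^ n / (fact n)\<^sup>2)"
    using assms by (simp add: norm_mult norm_divide norm_power)
  also have "\<dots> \<le> Gamma (Re z + real k + real n) / norm z ^ k * (q ^ n / (fact n)\<^sup>2)"
    using assms by (intro mult_right_mono norm_Gamma_add_nat_le) auto
  finally show ?thesis by (simp add: mult.commute)
qed

lemma summable_norm_Gamma_term:
  assumes "Re z > 0" "q \<ge> 0"
  shows "summable (\<lambda>n. norm (Gamma (z + of_nat n) * of_real q ^ n / (fact n)\<^sup>2))"
proof (rule summable_comparison_test')
  show "summable (\<lambda>n. Gamma (Re z + real n) * q ^ n / (fact n)\<^sup>2)"
    using assms by (rule summable_Gamma_power)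
  show "norm (norm (Gamma (z + of_nat n) * of_real q ^ n / (fact n)\<^sup>2)) \<le> Gamma (Re z + real n) * q ^ n / (fact n)\<^sup>2" for n
    using norm_Gamma_term_le[OF assms, of n 0] by simp
qed

text \<open>\<open>pochhammer z n\<close> is \<open>Gamma (z + n) / Gamma z\<close>, and
  \<open>pochhammer 1 n\<close> supplies the second factorial.\<close>

lemma Gamma_hyp1F1_sums:
  assumes "Re z > 0" "q \<ge> 0"
  shows "(\<lambda>n. Gamma (z + of_nat n) * of_real q ^ n / (fact n)\<^sup>2) sums (Gamma z * hyp1F1 z 1 (of_real q))"
proof -
  have z: "z \<notin> \<int>\<^sub>\<le>\<^sub>0" using assms by (auto elim!: nonpos_Ints_cases)
  then have G: "Gamma z \<noteq> 0" by (simp add: Gamma_eq_zero_iff)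
  have t: "pochhammer z n / pochhammer 1 n * of_real q ^ n / fact n
      = Gamma (z + of_nat n) * of_real q ^ n / (fact n)\<^sup>2 / Gamma z" for n
    using G by (simp add: pochhammer_Gamma[OF z] pochhammer_fact[symmetric] power2_eq_square)
  have s: "summable (\<lambda>n. Gamma (z + of_nat n) * of_real q ^ n / (fact n)\<^sup>2)"
    using summable_norm_Gamma_term[OF assms] by (rule summable_norm_cancel)
  have "Gamma z * hyp1F1 z 1 (of_real q) = (\<Sum>n. Gamma (z + of_nat n) * of_real q ^ n / (fact n)\<^sup>2)"
    unfolding hyp1F1_def t suminf_divide[OF s] using G by simp
  then show ?thesis using s by (simp add: sums_iff)
qed

lemma norm_Gamma_hyp1F1_le:
  assumes "Re z > 0" "q \<ge> 0"
  shows "norm (Gamma z * hyp1F1 z 1 (of_real q))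
    \<le> (\<Sum>n. Gamma (Re z + real k + real n) * q ^ n / (fact n)\<^sup>2) / norm z ^ k"
proof -
  have s: "summable (\<lambda>n. Gamma (Re z + real k + real n) * q ^ n / (fact n)\<^sup>2)"
    using assms by (intro summable_Gamma_power) auto
  have "norm (Gamma z * hyp1F1 z 1 (of_real q)) \<le> (\<Sum>n. norm (Gamma (z + of_nat n) * of_real q ^ n / (fact n)\<^sup>2))"
    unfolding sums_unique[OF Gamma_hyp1F1_sums[OF assms]]
    by (rule summable_norm[OF summable_norm_Gamma_term[OF assms]])
  also have "\<dots> \<le> (\<Sum>n. Gamma (Re z + real k + real n) * q ^ n / (fact n)\<^sup>2 * (1 / norm z ^ k))"
    by (intro suminf_le norm_Gamma_term_le assms summable_norm_Gamma_term summable_mult2 s)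
  also have "\<dots> = (\<Sum>n. Gamma (Re z + real k + real n) * q ^ n / (fact n)\<^sup>2) / norm z ^ k"
    by (subst suminf_mult2[OF s, symmetric]) simp
  finally show ?thesis .
qed

lemma measurable_Gamma_vertical:
  assumes "Re z > 0"
  shows "(\<lambda>\<tau>. Gamma (z + \<i> * of_real (\<tau> / 2))) \<in> borel_measurable borel"
  using borel_measurable_continuous_onI[OF continuous_on_Gamma_vertical[OF assms, of UNIV "1/2"]] by simp

lemma measurable_Gamma_term_vertical:
  assumes "Re z > 0"
  shows "(\<lambda>\<tau>. Gamma (z + \<i> * of_real (\<tau> / 2) + of_nat n) * of_real q ^ n / (fact n)\<^sup>2) \<in> borel_measurable borel"
proof -
  have [measurable]: "(\<lambda>\<tau>. Gamma (z + \<i> * of_real (\<tau> / 2) + of_nat n)) \<in> borel_measurable borel"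
    using measurable_Gamma_vertical[of "z + of_nat n"] assms by (simp add: add_ac)
  show ?thesis by measurable
qed

text \<open>Measurability is read off the series, whose terms are continuous along the line.\<close>

lemma measurable_Gamma_hyp1F1_vertical:
  assumes "Re z > 0" "q \<ge> 0"
  shows "(\<lambda>\<tau>. Gamma (z + \<i> * of_real (\<tau> / 2)) * hyp1F1 (z + \<i> * of_real (\<tau> / 2)) 1 (of_real q)) \<in> borel_measurable borel"
proof -
  have "(\<lambda>\<tau>. \<Sum>n. Gamma (z + \<i> * of_real (\<tau> / 2) + of_nat n) * of_real q ^ n / (fact n)\<^sup>2) \<in> borel_measurable borel"
    using measurable_Gamma_term_vertical[OF assms(1)] by (rule borel_measurable_suminf)
  also have "(\<lambda>\<tau>. \<Sum>n. Gamma (z + \<i> * of_real (\<tau> / 2) + of_nat n) * of_real q ^ n / (fact n)\<^sup>2)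
      = (\<lambda>\<tau>. Gamma (z + \<i> * of_real (\<tau> / 2)) * hyp1F1 (z + \<i> * of_real (\<tau> / 2)) 1 (of_real q))"
    using assms by (intro ext sums_unique[symmetric] Gamma_hyp1F1_sums) auto
  finally show ?thesis .
qed

text \<open>Term n is \<open>Cahen_Mellin\<close> at z + n. Moving the line by n costs the factor
  \<open>exp b ^ n\<close>, which joins \<open>q ^ n\<close>, while \<open>exp (- exp b)\<close> is
  common to all terms. The resulting series is the modified Bessel function of order 0 at 2 sqrt (q
  exp b).\<close>

lemma integral_Gamma_hyp1F1_vertical:
  fixes z :: complex and q b :: real
  assumes z: "Re z > 0" and q: "q \<ge> 0"
  shows "(CLINT \<tau>|lborel. Gamma (z + \<i> * of_real (\<tau> / 2)) * hyp1F1 (z + \<i> * of_real (\<tau> / 2)) 1 (of_real q)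
            * exp (- ((z + \<i> * of_real (\<tau> / 2)) * of_real b)))
    = 4 * pi * exp (- exp b) * (\<Sum>n. (q * exp b) ^ n / (fact n)\<^sup>2)"
proof -
  define s where "s \<tau> = z + \<i> * of_real (\<tau> / 2)" for \<tau> :: real
  have s: "Re (s \<tau>) = Re z" for \<tau> by (simp add: s_def)
  define f where "f n \<tau> = Gamma (s \<tau> + of_nat n) * of_real q ^ n / (fact n)\<^sup>2 * exp (- (s \<tau> * of_real b))" for n \<tau>
  \<comment> \<open>The 2 is the order of decay: term n is bounded by \<open>\<beta> n\<close> times
    one integrable function of \<tau>, so a single summable majorant justifies the
    interchange.\<close>
  define \<beta> where "\<beta> n = Gamma (Re z + real 2 + real n) * q ^ n / (fact n)\<^sup>2" for n
  have \<beta>: "summable \<beta>" unfolding \<beta>_def using z q by (intro summable_Gamma_power) auto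
  have [measurable]: "f n \<in> borel_measurable borel" for n
  proof -
    have [measurable]: "(\<lambda>\<tau>. Gamma (s \<tau> + of_nat n) * of_real q ^ n / (fact n)\<^sup>2) \<in> borel_measurable borel"
      unfolding s_def using z by (rule measurable_Gamma_term_vertical)
    have [measurable]: "s \<in> borel_measurable borel"
      unfolding s_def by measurable
    show ?thesis unfolding f_def by measurable
  qed
  have nf: "norm (f n \<tau>) \<le> \<beta> n * (1 / norm (s \<tau>) ^ 2 * exp (- (Re z * b)))" for n \<tau>
  proof -
    have "norm (f n \<tau>) = norm (Gamma (s \<tau> + of_nat n) * of_real q ^ n / (fact n)\<^sup>2) * exp (- (Re z * b))"
      unfolding f_def norm_mult[of _ "exp _"] by (simp add: norm_exp_eq_Re s)
    also have "\<dots> \<le> \<beta> n * (1 / norm (s \<tau>) ^ 2) * exp (- (Re z * b))"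
      using norm_Gamma_term_le[of "s \<tau>" q n 2] z q unfolding \<beta>_def s by (intro mult_right_mono) auto
    finally show ?thesis by (simp add: mult_ac)
  qed
  have inv: "integrable lborel (\<lambda>\<tau>. 1 / norm (s \<tau>) ^ 2 * exp (- (Re z * b)))"
    unfolding s_def using integrable_inverse_norm_square_vertical[OF z, of "1/2"] by (intro integrable_mult_left) simp
  define J where "J = (LINT \<tau>|lborel. 1 / norm (s \<tau>) ^ 2 * exp (- (Re z * b)))"
  have \<beta>0: "\<beta> n \<ge> 0" for n
  proof -
    have "Gamma (Re z + real 2 + real n) > 0" using z by (intro Gamma_real_pos) simp
    then show ?thesis using q by (simp add: \<beta>_def)
  qed
  have fi: "integrable lborel (f n)" for n
  proof (rule Bochner_Integration.integrable_bound[OF integrable_mult_right[OF inv, of "\<beta> n"]])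
    show "AE \<tau> in lborel. norm (f n \<tau>) \<le> norm (\<beta> n * (1 / norm (s \<tau>) ^ 2 * exp (- (Re z * b))))"
      using nf by (intro AE_I2) (metis abs_ge_self order_trans real_norm_def)
  qed simp
  have sn: "summable (\<lambda>n. norm (f n \<tau>))" for \<tau>
    by (rule summable_comparison_test'[OF summable_mult2[OF \<beta>, of "1 / norm (s \<tau>) ^ 2 * exp (- (Re z * b))"]])
       (simp only: real_norm_def abs_norm_cancel nf)
  have si: "summable (\<lambda>n. LINT \<tau>|lborel. norm (f n \<tau>))"
  proof (rule summable_comparison_test'[OF summable_mult2[OF \<beta>, of J]])
    show "norm (LINT \<tau>|lborel. norm (f n \<tau>)) \<le> \<beta> n * J" for n
    proof -
      have "(LINT \<tau>|lborel. norm (f n \<tau>)) \<le> (LINT \<tau>|lborel. \<beta> n * (1 / norm (s \<tau>) ^ 2 * exp (- (Re z * b))))"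
        using fi inv nf by (intro Bochner_Integration.integral_mono integrable_mult_right integrable_norm)
      also have "\<dots> = \<beta> n * J" unfolding J_def by (rule integral_mult_right_zero)
      finally show ?thesis by simp
    qed
  qed
  have int_f: "(CLINT \<tau>|lborel. f n \<tau>) = of_real (4 * pi * exp (- exp b) * ((q * exp b) ^ n / (fact n)\<^sup>2))" for n
  proof -
    have "f n \<tau> = of_real ((q * exp b) ^ n / (fact n)\<^sup>2) * (Gamma ((z + of_nat n) + \<i> * of_real (\<tau> / 2))
        * exp (- (((z + of_nat n) + \<i> * of_real (\<tau> / 2)) * of_real b)))" for \<tau>
    proof -
      have "exp (- (s \<tau> * of_real b)) = of_real (exp b) ^ n * exp (- ((s \<tau> + of_nat n) * of_real b))"
        unfolding exp_of_real[symmetric] exp_of_nat_mult[symmetric] exp_add[symmetric]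
        by (simp add: algebra_simps)
      then show ?thesis
        unfolding f_def by (simp add: s_def add_ac power_mult_distrib)
    qed
    then show ?thesis
      using Cahen_Mellin[of "z + of_nat n" b] z by (simp add: mult_ac)
  qed
  have "(CLINT \<tau>|lborel. Gamma (s \<tau>) * hyp1F1 (s \<tau>) 1 (of_real q) * exp (- (s \<tau> * of_real b)))
      = (CLINT \<tau>|lborel. (\<Sum>n. f n \<tau>))"
  proof (rule Bochner_Integration.integral_cong[OF refl])
    fix \<tau>
    show "Gamma (s \<tau>) * hyp1F1 (s \<tau>) 1 (of_real q) * exp (- (s \<tau> * of_real b)) = (\<Sum>n. f n \<tau>)"
      unfolding f_def using z q s by (intro sums_unique sums_mult2 Gamma_hyp1F1_sums) auto
  qed
  also have "\<dots> = (\<Sum>n. CLINT \<tau>|lborel. f n \<tau>)"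
    by (rule integral_suminf[OF fi _ si]) (simp add: sn)
  also have "\<dots> = of_real (\<Sum>n. 4 * pi * exp (- exp b) * ((q * exp b) ^ n / (fact n)\<^sup>2))"
  proof -
    have "summable (\<lambda>n. norm (CLINT \<tau>|lborel. f n \<tau>))"
      by (rule summable_comparison_test'[OF si]) (simp add: integral_norm_bound)
    then have "summable (\<lambda>n. 4 * pi * exp (- exp b) * ((q * exp b) ^ n / (fact n)\<^sup>2))"
      unfolding int_f norm_of_real by (rule summable_rabs_cancel)
    then show ?thesis unfolding int_f by (rule suminf_of_real[symmetric])
  qed
  also have "(\<Sum>n. 4 * pi * exp (- exp b) * ((q * exp b) ^ n / (fact n)\<^sup>2))
      = 4 * pi * exp (- exp b) * (\<Sum>n. (q * exp b) ^ n / (fact n)\<^sup>2)"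
  proof (rule suminf_mult)
    have "summable (\<lambda>n. (q * exp b) ^ n /\<^sub>R fact n)" by (rule summable_exp_generic)
    then have e: "summable (\<lambda>n. (q * exp b) ^ n / fact n)" by (simp add: field_simps)
    show "summable (\<lambda>n. (q * exp b) ^ n / (fact n)\<^sup>2)"
    proof (rule summable_comparison_test'[OF e])
      fix n :: nat
      have "fact n \<le> (fact n :: real)\<^sup>2"
        by (simp add: power2_eq_square fact_ge_1 mult_left_le[OF _ _])
      then show "norm ((q * exp b) ^ n / (fact n)\<^sup>2) \<le> (q * exp b) ^ n / fact n"
        using q by (auto intro!: divide_left_mono)
    qed
  qed
  finally show ?thesis by (simp add: s_def)
qed

text \<open>For positive x the real powers in \<open>bessel_I\<close> are ordinary ones; at 0 the
  leading term would be lost to \<open>0 powr 0 = 0\<close>.\<close>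

lemma bessel_I_0:
  assumes "x > 0"
  shows "bessel_I 0 x = (\<Sum>n. (x\<^sup>2 / 4) ^ n / (fact n)\<^sup>2)"
proof -
  have "1 / (fact n * Gamma (0 + real n + 1)) * (x / 2) powr (2 * real n + 0) = (x\<^sup>2 / 4) ^ n / (fact n)\<^sup>2" for n
  proof -
    have "(x / 2) powr (2 * real n + 0) = (x / 2) ^ (2 * n)"
      using assms powr_realpow[of "x/2" "2 * n"] by simp
    also have "\<dots> = (x\<^sup>2 / 4) ^ n" by (simp add: power_mult power_divide)
    finally show ?thesis by (simp add: Gamma_fact add.commute power2_eq_square)
  qed
  then show ?thesis unfolding bessel_I_def by simp
qed

section \<open>The integral representation of the solution\<close>

theorem theorem1p1:
  fixes \<kappa> r t :: real and g :: "real \<Rightarrow> complex" and S :: "complex set" and c :: complex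
  assumes "\<kappa> > 0" and "r > 0" and "t > 0"
    and "diffusion_integrand \<kappa> g r t integrable_on {0<..}"
    and "S \<subseteq> {s. Re s > -1}"
    and "S \<subseteq> interior {s. mellin_converges g (1 - s)}"
    and "(\<lambda>s. mellin g (1 - s)) analytic_on S"
    and "c \<in> S \<inter> {s. Re s > -1}"
  shows "vertical_integrable c (inversion_integrand \<kappa> g r t) \<and>
         diffusion_solution \<kappa> g r t =
           of_real (1 / r * exp (- (r\<^sup>2 - r\<^sup>2 / 2) / (4 * \<kappa> * t)))
             * (1 / (2 * of_real pi * \<i>))
             * vertical_integral c (inversion_integrand \<kappa> g r t)"
proof -
  define A where "A = 4 * \<kappa> * t"
  define q where "q = r\<^sup>2 / A"
  \<comment> \<open>Here \<open>z\<close> is fixed, the value of (s + 1)/2 at the base point c of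
    the contour; the point moving with \<tau> is \<open>s \<tau>\<close>.\<close>
  define z where "z = (c + 1) / 2"
  define s where "s \<tau> = z + \<i> * of_real (\<tau> / 2)" for \<tau> :: real
  \<comment> \<open>With this factor absorbed, the Mellin transform of g at 1 - (c + i\<tau>) is the
    integral \<open>m \<tau>\<close> of h against y powr (-i\<tau>).\<close>
  define h where "h y = of_real y powr (- c) * g y" for y :: real
  define \<Phi> where "\<Phi> \<tau> = Gamma (s \<tau>) * hyp1F1 (s \<tau>) 1 (of_real q) * of_real A powr ((c + \<i> * of_real \<tau>) / 2)" for \<tau>
  define m where "m \<tau> = integral {0<..} (\<lambda>y. exp (- (\<i> * \<tau> * of_real (ln y))) * h y)" for \<tau> :: real
  have A: "A > 0" using assms by (simp add: A_def)
  have q: "q > 0" using A assms by (simp add: q_def)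
  have z: "Re z > 0" using assms by (simp add: z_def)
  have s: "Re (s \<tau>) = Re z" for \<tau> by (simp add: s_def)
  have s_eq: "(c + \<i> * of_real \<tau>) / 2 + 1 / 2 = s \<tau>" for \<tau>
    by (simp add: s_def z_def field_simps)
  \<comment> \<open>Half the radius of this ball serves as \<delta>, so that c - \<delta> and c +
    \<delta> both lie in it; they provide the two integrability hypotheses of
    \<open>mellin_parseval\<close>.\<close>
  obtain e where e: "e > 0" "ball c e \<subseteq> {s. mellin_converges g (1 - s)}"
    using assms by (meson IntD1 mem_interior subsetD)
  define \<delta> where "\<delta> = e / 2"
  have \<delta>: "\<delta> > 0" using e by (simp add: \<delta>_def)
  have shift: "(\<lambda>y. of_real (y powr d) * h y) integrable_on {0<..}" if "\<bar>d\<bar> = \<delta>" for d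
  proof -
    have "c - of_real d \<in> ball c e" using that \<delta> by (simp add: dist_norm \<delta>_def)
    then have "mellin_converges g (1 - (c - of_real d))" using e by blast
    then show ?thesis
      unfolding mellin_converges_def
    proof (rule integrable_eq)
      fix y :: real assume "y \<in> {0<..}"
      then have "of_real y powr (1 - (c - of_real d) - 1) = of_real (y powr d) * of_real y powr (- c)"
        by (simp add: powr_def Ln_of_real exp_of_real[symmetric] exp_add[symmetric] algebra_simps)
      then show "of_real y powr (1 - (c - of_real d) - 1) * g y = of_real (y powr d) * h y"
        by (simp add: h_def)
    qed
  qed
  have nPhi: "norm (\<Phi> \<tau>) = norm (Gamma (s \<tau>) * hyp1F1 (s \<tau>) 1 (of_real q)) * A powr (Re c / 2)" for \<tau>
    unfolding \<Phi>_def norm_mult[of _ "_ powr _"] using A by (simp add: norm_powr_real_powr)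
  have meas: "\<Phi> \<in> borel_measurable borel"
  proof -
    have [measurable]: "(\<lambda>\<tau>. Gamma (s \<tau>) * hyp1F1 (s \<tau>) 1 (of_real q)) \<in> borel_measurable borel"
      unfolding s_def using z q by (intro measurable_Gamma_hyp1F1_vertical) auto
    have "of_real A powr w = exp (w * Ln (of_real A))" for w
      using A by (simp add: powr_def)
    then show ?thesis unfolding \<Phi>_def by simp
  qed
  have int: "integrable lborel (\<lambda>\<tau>. of_real (\<bar>\<tau>\<bar> + \<delta>) * \<Phi> \<tau>)"
  proof -
    \<comment> \<open>Four powers of decay: the weight \<bar>\<tau>\<bar> + \<delta> is bounded by a
      multiple of \<open>norm (s \<tau>) ^ 2\<close>, and the two powers left over make the quotient
      integrable.\<close>
    define B where "B = (\<Sum>n. Gamma (Re z + real 4 + real n) * q ^ n / (fact n)\<^sup>2)"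
    define D where "D = \<bar>Im c\<bar> + \<delta>"
    \<comment> \<open>On the line \<open>norm (s \<tau>)\<close> is at least \<open>Re z\<close>;
      dividing by \<open>Re z\<close> once or twice thus raises a linear or a constant term to a
      quadratic one.\<close>
    define K where "K = (2 / Re z + D / (Re z)\<^sup>2) * (B * A powr (Re c / 2))"
    have "integrable lborel (\<lambda>\<tau>. K * (1 / norm (s \<tau>) ^ 2))"
      unfolding s_def using integrable_inverse_norm_square_vertical[OF z, of "1/2"] by (intro integrable_mult_right) simp
    then show ?thesis
    proof (rule Bochner_Integration.integrable_bound)
      show "(\<lambda>\<tau>. of_real (\<bar>\<tau>\<bar> + \<delta>) * \<Phi> \<tau>) \<in> borel_measurable lborel"
        using meas by measurable
      have "norm (of_real (\<bar>\<tau>\<bar> + \<delta>) * \<Phi> \<tau>) \<le> K * (1 / norm (s \<tau>) ^ 2)" for \<tau>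
      proof -
        define N where "N = norm (s \<tau>)"
        have N: "Re z \<le> N" using complex_Re_le_cmod[of "s \<tau>"] by (simp add: N_def s)
        have "\<tau> = 2 * Im (s \<tau>) - Im c" by (simp add: s_def z_def)
        then have "\<bar>\<tau>\<bar> \<le> 2 * \<bar>Im (s \<tau>)\<bar> + \<bar>Im c\<bar>" by linarith
        then have "\<bar>\<tau>\<bar> + \<delta> \<le> 2 * N + D" using abs_Im_le_cmod[of "s \<tau>"] by (simp add: N_def D_def)
        also have "\<dots> \<le> (2 / Re z + D / (Re z)\<^sup>2) * N\<^sup>2"
        proof -
          have "2 * N \<le> 2 / Re z * N\<^sup>2"
            using z N mult_left_mono[OF N, of N] by (simp add: field_simps power2_eq_square)
          moreover have "D * 1 \<le> D * (N\<^sup>2 / (Re z)\<^sup>2)"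
            using z N \<delta> by (intro mult_left_mono) (auto simp: D_def intro!: power_mono)
          ultimately show ?thesis by (simp add: algebra_simps)
        qed
        finally have 1: "\<bar>\<tau>\<bar> + \<delta> \<le> (2 / Re z + D / (Re z)\<^sup>2) * N\<^sup>2" .
        have 2: "norm (\<Phi> \<tau>) \<le> B / N ^ 4 * A powr (Re c / 2)"
          unfolding nPhi N_def B_def using norm_Gamma_hyp1F1_le[of "s \<tau>" q 4] z q
          by (intro mult_right_mono) (auto simp: s)
        have "norm (of_real (\<bar>\<tau>\<bar> + \<delta>) * \<Phi> \<tau>) = (\<bar>\<tau>\<bar> + \<delta>) * norm (\<Phi> \<tau>)"
          using \<delta> by (simp add: norm_mult flip: of_real_add)
        also have "\<dots> \<le> ((2 / Re z + D / (Re z)\<^sup>2) * N\<^sup>2) * (B / N ^ 4 * A powr (Re c / 2))"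
          using \<delta> order_trans[OF _ 1] by (intro mult_mono 1 2) auto
        also have "\<dots> = K * (1 / N\<^sup>2)"
          using z N by (simp add: K_def power4_eq_xxxx power2_eq_square)
        finally show ?thesis unfolding N_def .
      qed
      then show "AE \<tau> in lborel. norm (of_real (\<bar>\<tau>\<bar> + \<delta>) * \<Phi> \<tau>) \<le> norm (K * (1 / norm (s \<tau>) ^ 2))"
        by (intro AE_I2) (metis abs_ge_self order_trans real_norm_def)
    qed
  qed
  note parseval = mellin_parseval[OF \<delta> shift shift meas int, folded m_def]
  have \<Phi>m: "integrable lborel (\<lambda>\<tau>. \<Phi> \<tau> * m \<tau>)"
    using parseval(1) \<delta> by simp
  \<comment> \<open>The constant combines 4\<pi> from the vertical integral with A powr (-1/2),
    which remains because the exponent s/2 of A falls short of (s + 1)/2 by 1/2.\<close>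
  have inv: "h y * (LINT \<tau>|lborel. \<Phi> \<tau> * exp (- (\<i> * \<tau> * of_real (ln y))))
      = of_real (4 * pi / sqrt A) * diffusion_integrand \<kappa> g r t y" if y: "y > 0" for y
  proof -
    \<comment> \<open>Since 2 \<open>s \<tau>\<close> = c + 1 + i\<tau>, the powers y powr
      (-i\<tau>) and A powr ((c + i\<tau>)/2) combine to y powr (c + 1) / sqrt A times exp (-
      \<open>s \<tau>\<close> b), with exp b = y^2/A.\<close>
    define b where "b = 2 * ln y - ln A"
    have b: "exp b = y\<^sup>2 / A"
      using y A by (simp add: b_def exp_diff exp_double)
    have x: "y * r / (2 * \<kappa> * t) > 0" using y assms by simp
    have "\<Phi> \<tau> * exp (- (\<i> * \<tau> * of_real (ln y)))
        = (of_real y powr (c + 1) * of_real (1 / sqrt A)) * (Gamma (s \<tau>) * hyp1F1 (s \<tau>) 1 (of_real q)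
            * exp (- (s \<tau> * of_real b)))" for \<tau>
    proof -
      have "1 / sqrt A = exp (- (1/2 * ln A))"
        using A by (simp add: exp_minus powr_half_sqrt[symmetric] powr_def inverse_eq_divide)
      then have 1: "complex_of_real (1 / sqrt A) = exp (- (of_real (ln A) / 2))"
        by (simp only: exp_of_real[symmetric]) simp
      have 2: "complex_of_real x powr w = exp (w * of_real (ln x))" if "x > 0" for x w
        using that by (simp add: powr_def Ln_of_real)
      have "of_real y powr (c + 1) * of_real (1 / sqrt A) * exp (- (s \<tau> * of_real b))
          = of_real A powr ((c + \<i> * of_real \<tau>) / 2) * exp (- (\<i> * \<tau> * of_real (ln y)))"
        unfolding 1 2[OF y] 2[OF A] exp_add[symmetric]
        by (rule arg_cong[of _ _ exp]) (simp add: b_def s_def z_def field_simps)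
      then show ?thesis unfolding \<Phi>_def by (simp add: mult_ac)
    qed
    then have "(LINT \<tau>|lborel. \<Phi> \<tau> * exp (- (\<i> * \<tau> * of_real (ln y))))
        = (of_real y powr (c + 1) * of_real (1 / sqrt A)) * of_real (4 * pi * exp (- exp b) * (\<Sum>n. (q * exp b) ^ n / (fact n)\<^sup>2))"
      using integral_Gamma_hyp1F1_vertical[OF z, of q b] q unfolding s_def by (simp del: of_real_mult of_real_divide)
    also have "(\<Sum>n. (q * exp b) ^ n / (fact n)\<^sup>2) = bessel_I 0 (y * r / (2 * \<kappa> * t))"
    proof -
      have "q * exp b = (y * r / (2 * \<kappa> * t))\<^sup>2 / 4"
        unfolding b q_def A_def by (simp add: power2_eq_square)
      then show ?thesis by (simp only: bessel_I_0[OF x])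
    qed
    also have "h y * ((of_real y powr (c + 1) * of_real (1 / sqrt A)) * of_real (4 * pi * exp (- exp b) * bessel_I 0 (y * r / (2 * \<kappa> * t))))
        = of_real (4 * pi / sqrt A) * diffusion_integrand \<kappa> g r t y"
    proof -
      have "of_real y powr (- c) * of_real y powr (c + 1) = complex_of_real y"
        using y by (simp add: powr_add[symmetric])
      then show ?thesis
        unfolding h_def diffusion_integrand_def b A_def[symmetric] by (simp add: mult_ac)
    qed
    finally show ?thesis .
  qed
  have "((\<lambda>y. of_real (4 * pi / sqrt A) * diffusion_integrand \<kappa> g r t y) has_integral (LINT \<tau>|lborel. \<Phi> \<tau> * m \<tau>)) {0<..}"
    using inv \<delta> by (intro has_integral_eq[OF _ parseval(2)]) auto
  then have "integral {0<..} (\<lambda>y. of_real (4 * pi / sqrt A) * diffusion_integrand \<kappa> g r t y) = (LINT \<tau>|lborel. \<Phi> \<tau> * m \<tau>)"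
    by (rule integral_unique)
  then have I: "of_real (4 * pi / sqrt A) * integral {0<..} (diffusion_integrand \<kappa> g r t) = (LINT \<tau>|lborel. \<Phi> \<tau> * m \<tau>)"
    by simp
  have mel: "mellin g (1 - (c + \<i> * of_real \<tau>)) = m \<tau>" for \<tau>
    unfolding mellin_def m_def
  proof (rule integral_cong)
    fix y :: real assume "y \<in> {0<..}"
    then have "of_real y powr (1 - (c + \<i> * of_real \<tau>) - 1) = exp (- (\<i> * \<tau> * of_real (ln y))) * of_real y powr (- c)"
      by (simp add: powr_def Ln_of_real exp_add[symmetric] algebra_simps)
    then show "of_real y powr (1 - (c + \<i> * of_real \<tau>) - 1) * g y = exp (- (\<i> * \<tau> * of_real (ln y))) * h y"
      by (simp add: h_def)
  qed
  \<comment> \<open>For order 0 the Whittaker function is \<open>sqrt q * exp (- q / 2)\<close>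
    times the confluent hypergeometric function; its first parameter s/2 + 1/2 is also the argument
    of \<Gamma>.\<close>
  have J: "inversion_integrand \<kappa> g r t (c + \<i> * of_real \<tau>) = of_real (sqrt q * exp (- q / 2)) * (\<Phi> \<tau> * m \<tau>)" for \<tau>
  proof -
    have "of_real q powr (1/2) = complex_of_real (sqrt q)"
      using q powr_of_real[of q "1/2"] by (simp add: powr_half_sqrt)
    moreover have "exp (- complex_of_real q / 2) = of_real (exp (- q / 2))"
      by (simp only: exp_of_real[symmetric]) simp
    moreover have "0 - - (c + \<i> * of_real \<tau>) / 2 + 1 / 2 = s \<tau>"
      unfolding s_eq[symmetric] minus_divide_left[symmetric] by (simp only: minus_minus diff_0)
    ultimately show ?thesis
      unfolding inversion_integrand_def whittaker_M_def mel \<Phi>_def s_eq A_def[symmetric] q_def[symmetric]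
      by (simp add: mult_ac)
  qed
  have Jint: "((\<lambda>\<tau>. inversion_integrand \<kappa> g r t (c + \<i> * of_real \<tau>)) has_integral
      of_real (sqrt q * exp (- q / 2)) * (LINT \<tau>|lborel. \<Phi> \<tau> * m \<tau>)) UNIV"
    unfolding J by (intro has_integral_mult_right has_integral_integral_lborel \<Phi>m)
  have "diffusion_solution \<kappa> g r t = of_real (2 / A * exp (- q)) * integral {0<..} (diffusion_integrand \<kappa> g r t)"
    unfolding diffusion_solution_def q_def A_def by simp
  also have "\<dots> = of_real (2 / A * exp (- q) * (sqrt A / (4 * pi))) * (LINT \<tau>|lborel. \<Phi> \<tau> * m \<tau>)"
    unfolding I[symmetric] using A by simp
  \<comment> \<open>One half of the exponent in \<open>exp (- q)\<close> comes from the Whittaker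
    function and the other half is the outer exponential; sqrt A / A = sqrt q / r accounts for
    1/r.\<close>
  also have "2 / A * exp (- q) * (sqrt A / (4 * pi)) = 1 / r * exp (- (r\<^sup>2 - r\<^sup>2 / 2) / A) * (1 / (2 * pi)) * (sqrt q * exp (- q / 2))"
  proof -
    have "exp (- q) = exp (- (r\<^sup>2 - r\<^sup>2 / 2) / A) * exp (- q / 2)"
      by (simp add: q_def exp_add[symmetric])
    moreover have "sqrt A / A = sqrt q / r"
      using A assms(2) by (simp add: q_def real_sqrt_divide real_sqrt_abs field_simps)
    moreover have "2 / A * exp (- q) * (sqrt A / (4 * pi)) = (sqrt A / A) * exp (- q) / (2 * pi)"
      by simp
    ultimately show ?thesis by simp
  qed
  also have "of_real \<dots> * (LINT \<tau>|lborel. \<Phi> \<tau> * m \<tau>) = of_real (1 / r * exp (- (r\<^sup>2 - r\<^sup>2 / 2) / (4 * \<kappa> * t)))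
             * (1 / (2 * of_real pi * \<i>)) * vertical_integral c (inversion_integrand \<kappa> g r t)"
    unfolding vertical_integral_def integral_unique[OF Jint] A_def[symmetric] by simp
  finally show ?thesis
    using Jint unfolding vertical_integrable_def by blast
qed

end
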